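(* Let $Q_1, Q_2$ be non-empty polytopes such that one of them is a pyramid. Then \[xc_{SDP}(Q_1\times Q_2) \geq xc_{SDP}(Q_1) + xc_{SDP}(Q_2) - 1. \]
   Context: For a convex set $K\subseteq\mathbb{R}^n$, $xc_{SDP}(K)$ is the minimum $r$ such that there exist $a_i\in\mathbb{R}^n$, $U_i\in\mathbb{S}^r_+$, $b_i\in\mathbb{R}$ ($i\in I$) with $x\in K$ iff there exists $Y\in\mathbb{S}^r_+$ with $a_i^Tx+\langle U_i,Y\rangle=b_i$ for all $i\in I$ ($\mathbb{S}^r_+$ denotes $r\times r$ symmetric positive semidefinite matrices, $\langle\cdot,\cdot\rangle$ the Frobenius inner product). A polytope $Q$ is a pyramid with base $B$ and apex $v$ if $Q=\mathrm{conv}(B\cup\{v\})$ and $v$ is not in the affine hull of $B$. *)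

theory Defs
  imports "HOL-Analysis.Analysis" "HOL-Library.Extended_Nat" "Jordan_Normal_Form.Matrix"
begin

(* The size r is quantified inside the definition of xc_SDP, so r x r matrices are matrices
   with an explicit carrier. Carrier size 0 is allowed. *)
definition psd_matrices :: "nat \<Rightarrow> real mat set" where
  "psd_matrices r =
     {A \<in> carrier_mat r r. transpose_mat A = A \<and>
        (\<forall>v \<in> carrier_vec r. scalar_prod v (mult_mat_vec A v) \<ge> 0)}"

definition frobenius_inner :: "real mat \<Rightarrow> real mat \<Rightarrow> real" where
  "frobenius_inner A B = (\<Sum>i<dim_row A. \<Sum>j<dim_col A. A $$ (i, j) * B $$ (i, j))"

(* The family (a_i, U_i, b_i), i in I, over an arbitrary index set I is given by the set S of
   its members; repetitions in the family do not matter. *)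
definition has_sdp_formulation :: "'a::euclidean_space set \<Rightarrow> nat \<Rightarrow> bool" where
  "has_sdp_formulation K r \<longleftrightarrow>
     (\<exists>S :: ('a \<times> real mat \<times> real) set.
        (\<forall>(a, U, b) \<in> S. U \<in> psd_matrices r) \<and>
        (\<forall>x. x \<in> K \<longleftrightarrow>
           (\<exists>Y \<in> psd_matrices r. \<forall>(a, U, b) \<in> S. inner a x + frobenius_inner U Y = b)))"

(* The infimum in enat is the minimum if some formulation exists (as for every polytope),
   and infinity otherwise. *)
definition xc_SDP :: "'a::euclidean_space set \<Rightarrow> enat" where
  "xc_SDP K = (INF r \<in> {r. has_sdp_formulation K r}. enat r)"

definition pyramid_with :: "'a::euclidean_space set \<Rightarrow> 'a set \<Rightarrow> 'a \<Rightarrow> bool" where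
  "pyramid_with Q B v \<longleftrightarrow>
     polytope Q \<and> Q = convex hull (B \<union> {v}) \<and> v \<notin> affine hull B"

(* B need not be assumed to be a polytope: replacing B by its convex hull, which is a face of
   the polytope Q, changes neither Q nor the affine hull. *)
definition is_pyramid :: "'a::euclidean_space set \<Rightarrow> bool" where
  "is_pyramid Q \<longleftrightarrow> (\<exists>B v. pyramid_with Q B v)"

end

theory Submission
  imports Defs "Jordan_Normal_Form.Determinant"
begin

text \<open>Let \<open>v\<close> be the apex of the pyramid \<open>Q1\<close> and take a formulation of \<open>Q1 \<times> Q2\<close> of minimal
  size \<open>r\<close>. The matrices \<open>Y\<close> that are feasible over \<open>{v} \<times> Q2\<close> have a common kernel; after a
  congruence it is spanned by the last \<open>r - t\<close> unit vectors, so the upper left \<open>t \<times> t\<close> blocks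
  give a formulation of \<open>Q2\<close>. By minimality some feasible matrix is positive definite, hence
  conic duality holds and every linear inequality that is valid on \<open>Q1\<close> and tight at \<open>v\<close> has
  its slack of the form \<open>\<langle>W, Y\<rangle>\<close> with \<open>W\<close> psd. This slack vanishes over \<open>{v} \<times> Q2\<close>, so \<open>W\<close>
  is supported on the complementary block. Thus the tangent cone of \<open>Q1\<close> at \<open>v\<close> has a formulation of
  size \<open>r - t\<close>, and one more diagonal entry, the slack of the inequality of the base, cuts \<open>Q1\<close>
  out of this cone.\<close>

subsection \<open>Positive semidefinite matrices and congruence\<close>

text \<open>Semidefinite duality need not attain its optimum unless some feasible matrix is positive
  definite; this is why the formulation of the product is taken of minimal size. Duality gives a
  slack of the form \<open>frobenius_inner W Y + c\<close> with \<open>c \<ge> 0\<close>. Over the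
  apex the slack is zero, so both nonnegative summands vanish there: the constant disappears, and
  \<open>W\<close> must avoid the block that carries \<open>Q2\<close>. Hence the two factors use
  disjoint diagonal blocks, of sizes \<open>t\<close> and \<open>r - t\<close>. The pyramid enters
  because all of its inequalities except that of the base are tight at the single point
  \<open>v\<close>, so one facial reduction serves all of them at once; the base costs one extra
  row, which accounts for the \<open>1\<close> in the bound. The coefficient matrices of a
  formulation have to be psd themselves, and the dual certificates \<open>W\<close> are. Since the
  family may be infinite, all tight inequalities can be imposed together.\<close>

definition bil_form :: "nat \<Rightarrow> real mat \<Rightarrow> (nat \<Rightarrow> real) \<Rightarrow> (nat \<Rightarrow> real) \<Rightarrow> real" where
  "bil_form r A u v = (\<Sum>i<r. \<Sum>j<r. A $$ (i, j) * u i * v j)"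

lemma bil_form_linear_left:
  "bil_form r A (\<lambda>i. a * u i + b * w i) v = a * bil_form r A u v + b * bil_form r A w v"
  by (simp add: bil_form_def sum_distrib_left sum.distrib algebra_simps)

lemma bil_form_linear_right:
  "bil_form r A v (\<lambda>i. a * u i + b * w i) = a * bil_form r A v u + b * bil_form r A v w"
  by (simp add: bil_form_def sum_distrib_left sum.distrib algebra_simps)

lemma bil_form_cong:
  "(\<And>i. i < r \<Longrightarrow> u i = u' i) \<Longrightarrow> (\<And>i. i < r \<Longrightarrow> v i = v' i) \<Longrightarrow>
    bil_form r A u v = bil_form r A u' v'"
  by (simp add: bil_form_def)

lemma bil_form_unit:
  assumes "k < r" "l < r"
  shows "bil_form r A (\<lambda>i. if i = k then 1 else 0) (\<lambda>i. if i = l then 1 else 0) = A $$ (k, l)"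
proof -
  have "A $$ (i, j) * (if i = k then 1 else 0) * (if j = l then 1 else 0) =
      (if j = l then (if i = k then A $$ (i, j) else 0) else 0)" for i j
    by simp
  then show ?thesis
    using assms by (simp add: bil_form_def sum.delta)
qed

text \<open>Vectors with a carrier are traded for functions on \<open>nat\<close>; the values beyond
  \<open>r\<close> do not enter \<open>bil_form\<close>, so no carrier conditions on vectors arise
  later.\<close>

lemma psd_iff:
  "A \<in> psd_matrices r \<longleftrightarrow> A \<in> carrier_mat r r \<and>
     (\<forall>i<r. \<forall>j<r. A $$ (i, j) = A $$ (j, i)) \<and> (\<forall>v. bil_form r A v v \<ge> 0)"
proof (cases "A \<in> carrier_mat r r")
  case True
  have sp: "scalar_prod v (mult_mat_vec A v) = bil_form r A (($) v) (($) v)" if "v \<in> carrier_vec r" for v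
    using True that
    by (auto simp: bil_form_def scalar_prod_def sum_distrib_left atLeast0LessThan algebra_simps
        intro!: sum.cong)
  have "(\<forall>v \<in> carrier_vec r. scalar_prod v (mult_mat_vec A v) \<ge> 0) \<longleftrightarrow> (\<forall>v. bil_form r A v v \<ge> 0)"
  proof (intro iffI allI ballI)
    fix v assume *: "\<forall>v \<in> carrier_vec r. scalar_prod v (mult_mat_vec A v) \<ge> 0"
    have "bil_form r A v v = bil_form r A (($) (vec r v)) (($) (vec r v))"
      by (rule bil_form_cong) auto
    then show "bil_form r A v v \<ge> 0"
      using *[rule_format, of "vec r v"] sp[of "vec r v"] by simp
  qed (simp add: sp)
  moreover have "transpose_mat A = A \<longleftrightarrow> (\<forall>i<r. \<forall>j<r. A $$ (i, j) = A $$ (j, i))"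
  proof
    assume t: "transpose_mat A = A"
    show "\<forall>i<r. \<forall>j<r. A $$ (i, j) = A $$ (j, i)"
      using True t by (metis carrier_matD index_transpose_mat(1))
  qed (use True in auto)
  ultimately show ?thesis
    using True by (simp add: psd_matrices_def)
qed (simp add: psd_matrices_def)

lemma psd_carrier: "A \<in> psd_matrices r \<Longrightarrow> A \<in> carrier_mat r r"
  by (simp add: psd_iff)

lemma psd_sym: "A \<in> psd_matrices r \<Longrightarrow> i < r \<Longrightarrow> j < r \<Longrightarrow> A $$ (i, j) = A $$ (j, i)"
  by (simp add: psd_iff)

lemma psdI:
  "A \<in> carrier_mat r r \<Longrightarrow> (\<And>i j. i < r \<Longrightarrow> j < r \<Longrightarrow> A $$ (i, j) = A $$ (j, i)) \<Longrightarrow>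
    (\<And>v. bil_form r A v v \<ge> 0) \<Longrightarrow> A \<in> psd_matrices r"
  by (simp add: psd_iff)

lemma psd_nonneg: "A \<in> psd_matrices r \<Longrightarrow> bil_form r A v v \<ge> 0"
  by (simp add: psd_iff)

lemma bil_form_commute:
  assumes "A \<in> psd_matrices r"
  shows "bil_form r A u v = bil_form r A v u"
proof -
  have "bil_form r A u v = (\<Sum>i<r. \<Sum>j<r. A $$ (j, i) * u i * v j)"
    unfolding bil_form_def using assms by (intro sum.cong refl) (auto simp: psd_iff)
  also have "\<dots> = bil_form r A v u"
    unfolding bil_form_def by (subst sum.swap) (simp add: algebra_simps)
  finally show ?thesis .
qed

lemma bil_form_comb:
  assumes "A \<in> psd_matrices r"
  shows "bil_form r A (\<lambda>i. a * u i + b * w i) (\<lambda>i. a * u i + b * w i) =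
    a\<^sup>2 * bil_form r A u u + 2 * a * b * bil_form r A u w + b\<^sup>2 * bil_form r A w w"
  using bil_form_commute[OF assms, of w u]
  by (simp add: bil_form_linear_left bil_form_linear_right power2_eq_square algebra_simps)

text \<open>For isotropic \<open>u\<close> the form at \<open>x u + v\<close> is affine in
  \<open>x\<close>, and an affine function that is nowhere negative has slope zero.\<close>

lemma bil_form_kernel:
  assumes "A \<in> psd_matrices r" and "bil_form r A u u = 0"
  shows "bil_form r A u v = 0"
proof (rule ccontr)
  assume ne: "bil_form r A u v \<noteq> 0"
  let ?b = "bil_form r A u v" and ?c = "bil_form r A v v"
  \<comment> \<open>Solves \<open>2 * x * ?b + ?c = -1\<close>.\<close>
  define x where "x = - (?c + 1) / (2 * ?b)"
  have "0 \<le> bil_form r A (\<lambda>i. x * u i + 1 * v i) (\<lambda>i. x * u i + 1 * v i)"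
    using assms(1) psd_iff by blast
  also have "\<dots> = 2 * x * ?b + ?c"
    using assms by (subst bil_form_comb) auto
  also have "\<dots> = -1"
    using ne by (simp add: x_def field_simps)
  finally show False by simp
qed

lemma bil_form_Cauchy_Schwarz:
  assumes "A \<in> psd_matrices r"
  shows "(bil_form r A u v)\<^sup>2 \<le> bil_form r A u u * bil_form r A v v"
proof (cases "bil_form r A u u = 0")
  case True
  then show ?thesis using bil_form_kernel[OF assms] by simp
next
  case False
  let ?a = "bil_form r A u u" and ?b = "bil_form r A u v" and ?c = "bil_form r A v v"
  have "?a \<ge> 0" using assms psd_iff by blast
  then have pos: "?a > 0" using False by simp
  have "0 \<le> bil_form r A (\<lambda>i. (- ?b) * u i + ?a * v i) (\<lambda>i. (- ?b) * u i + ?a * v i)"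
    using assms psd_iff by blast
  also have "\<dots> = ?a * (?a * ?c - ?b\<^sup>2)"
    by (subst bil_form_comb[OF assms]) (simp add: power2_eq_square algebra_simps)
  finally show ?thesis
    using pos by (simp add: zero_le_mult_iff)
qed

text \<open>The unit vector at \<open>i\<close> is isotropic, hence in the kernel. Because of this,
  later lemmas only keep track of diagonal entries.\<close>

lemma psd_diag_zero:
  assumes "A \<in> psd_matrices r" "i < r" "j < r" "A $$ (i, i) = 0"
  shows "A $$ (i, j) = 0" "A $$ (j, i) = 0"
proof -
  show *: "A $$ (i, j) = 0"
    using bil_form_kernel[OF assms(1), of "\<lambda>k. if k = i then 1 else 0" "\<lambda>k. if k = j then 1 else 0"]
      assms(2-4) by (simp add: bil_form_unit)
  show "A $$ (j, i) = 0"
    using * assms by (simp add: psd_iff)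
qed

section \<open>Change of coordinates by congruence\<close>

lemma sum_pairs_swap:
  "(\<Sum>i\<in>A. \<Sum>j\<in>B. \<Sum>k\<in>C. \<Sum>l\<in>D. f i j k l) =
   (\<Sum>k\<in>C. \<Sum>l\<in>D. \<Sum>i\<in>A. \<Sum>j\<in>B. (f i j k l :: 'a::comm_monoid_add))"
proof -
  have "(\<Sum>x\<in>A \<times> B. \<Sum>y\<in>C \<times> D. f (fst x) (snd x) (fst y) (snd y)) =
        (\<Sum>y\<in>C \<times> D. \<Sum>x\<in>A \<times> B. f (fst x) (snd x) (fst y) (snd y))"
    by (rule sum.swap)
  then show ?thesis
    by (simp add: sum.cartesian_product')
qed

definition mat_app :: "nat \<Rightarrow> real mat \<Rightarrow> (nat \<Rightarrow> real) \<Rightarrow> nat \<Rightarrow> real" where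
  "mat_app r P u = (\<lambda>i. \<Sum>j<r. P $$ (i, j) * u j)"

definition congruence :: "real mat \<Rightarrow> real mat \<Rightarrow> real mat" where
  "congruence P A = transpose_mat P * A * P"

lemma congruence_carrier [simp]:
  "P \<in> carrier_mat r r \<Longrightarrow> A \<in> carrier_mat r r \<Longrightarrow> congruence P A \<in> carrier_mat r r"
  by (simp add: congruence_def)

lemma congruence_index:
  assumes "P \<in> carrier_mat r r" "A \<in> carrier_mat r r" "i < r" "j < r"
  shows "congruence P A $$ (i, j) = bil_form r A (\<lambda>k. P $$ (k, i)) (\<lambda>k. P $$ (k, j))"
proof -
  have "congruence P A = transpose_mat P * (A * P)"
    using assms by (simp add: congruence_def assoc_mult_mat[of _ r r _ r _ r])
  then have "congruence P A $$ (i, j) = (\<Sum>k<r. P $$ (k, i) * (\<Sum>l<r. A $$ (k, l) * P $$ (l, j)))"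
    using assms by (simp add: scalar_prod_def atLeast0LessThan)
  then show ?thesis
    by (simp add: bil_form_def sum_distrib_left mult_ac)
qed

lemma bil_form_congruence:
  assumes "P \<in> carrier_mat r r" "A \<in> carrier_mat r r"
  shows "bil_form r (congruence P A) u v = bil_form r A (mat_app r P u) (mat_app r P v)"
proof -
  have "bil_form r (congruence P A) u v =
      (\<Sum>i<r. \<Sum>j<r. (\<Sum>k<r. \<Sum>l<r. A $$ (k, l) * P $$ (k, i) * P $$ (l, j)) * u i * v j)"
    using assms by (simp add: bil_form_def congruence_index)
  also have "\<dots> = (\<Sum>i<r. \<Sum>j<r. \<Sum>k<r. \<Sum>l<r. A $$ (k, l) * (P $$ (k, i) * u i) * (P $$ (l, j) * v j))"
    by (simp add: sum_distrib_right sum_distrib_left mult_ac)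
  also have "\<dots> = (\<Sum>k<r. \<Sum>l<r. \<Sum>i<r. \<Sum>j<r. A $$ (k, l) * (P $$ (k, i) * u i) * (P $$ (l, j) * v j))"
    by (rule sum_pairs_swap)
  also have "\<dots> = bil_form r A (mat_app r P u) (mat_app r P v)"
    by (simp add: bil_form_def mat_app_def sum_distrib_right sum_distrib_left mult_ac)
  finally show ?thesis .
qed

lemma congruence_psd:
  assumes "P \<in> carrier_mat r r" "A \<in> psd_matrices r"
  shows "congruence P A \<in> psd_matrices r"
proof -
  have A: "A \<in> carrier_mat r r" using assms by (simp add: psd_iff)
  have "\<forall>v. bil_form r A v v \<ge> 0" using assms(2) psd_iff by blast
  then show ?thesis
    unfolding psd_iff
    using assms A bil_form_commute[OF assms(2)]
    by (auto simp: congruence_index bil_form_congruence)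
qed

lemma frobenius_inner_carrier:
  "A \<in> carrier_mat r r \<Longrightarrow> frobenius_inner A B = (\<Sum>i<r. \<Sum>j<r. A $$ (i, j) * B $$ (i, j))"
  by (auto simp: frobenius_inner_def)

text \<open>Congruence with the transpose is the adjoint for the Frobenius product, so a
  substitution in \<open>Y\<close> can be absorbed by the coefficient matrices.\<close>

lemma frobenius_inner_congruence:
  assumes "Q \<in> carrier_mat r r" "U \<in> carrier_mat r r" "Z \<in> carrier_mat r r"
  shows "frobenius_inner (congruence (transpose_mat Q) U) Z = frobenius_inner U (congruence Q Z)"
proof -
  have "frobenius_inner (congruence (transpose_mat Q) U) Z =
      (\<Sum>i<r. \<Sum>j<r. \<Sum>k<r. \<Sum>l<r. U $$ (k, l) * (Z $$ (i, j) * Q $$ (i, k) * Q $$ (j, l)))"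
    using assms by (simp add: frobenius_inner_carrier[of _ r] congruence_index[of _ r] bil_form_def
        sum_distrib_right sum_distrib_left mult_ac)
  also have "\<dots> = (\<Sum>k<r. \<Sum>l<r. \<Sum>i<r. \<Sum>j<r. U $$ (k, l) * (Z $$ (i, j) * Q $$ (i, k) * Q $$ (j, l)))"
    by (rule sum_pairs_swap)
  also have "\<dots> = frobenius_inner U (congruence Q Z)"
    using assms by (simp add: frobenius_inner_carrier[of _ r] congruence_index[of _ r] bil_form_def
        sum_distrib_left)
  finally show ?thesis .
qed

lemma congruence_inverse:
  assumes "P \<in> carrier_mat r r" "Q \<in> carrier_mat r r" "A \<in> carrier_mat r r" "P * Q = 1\<^sub>m r"
  shows "congruence Q (congruence P A) = A"
proof -
  have "transpose_mat Q * transpose_mat P = 1\<^sub>m r"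
    using assms by (metis transpose_mult transpose_one)
  moreover have "congruence Q (congruence P A) = (transpose_mat Q * transpose_mat P) * A * (P * Q)"
    using assms by (simp add: congruence_def assoc_mult_mat[of _ r r _ r _ r])
  ultimately show ?thesis
    using assms by simp
qed

text \<open>Choose \<open>t\<close> minimal: a nonzero combination of the first \<open>t\<close> columns that lies in \<open>N\<close> could
  be exchanged for one of these columns.\<close>

lemma adapted_basis:
  fixes N :: "real vec set"
  obtains P Q t where "P \<in> carrier_mat r r" "Q \<in> carrier_mat r r" "P * Q = 1\<^sub>m r" "Q * P = 1\<^sub>m r"
    "t \<le> r" "\<And>i. t \<le> i \<Longrightarrow> i < r \<Longrightarrow> col P i \<in> N"
    "\<And>c. c \<in> carrier_vec r \<Longrightarrow> (\<And>i. t \<le> i \<Longrightarrow> i < r \<Longrightarrow> c $ i = 0) \<Longrightarrow>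
       P *\<^sub>v c \<in> N \<Longrightarrow> c = 0\<^sub>v r"
proof -
  define ok where "ok t \<longleftrightarrow> (\<exists>P Q. P \<in> carrier_mat r r \<and> Q \<in> carrier_mat r r \<and>
    P * Q = 1\<^sub>m r \<and> Q * P = 1\<^sub>m r \<and> t \<le> r \<and> (\<forall>i. t \<le> i \<longrightarrow> i < r \<longrightarrow> col P i \<in> N))" for t
  have "ok r"
    unfolding ok_def by (intro exI[of _ "1\<^sub>m r"]) auto
  define t where "t = (LEAST t. ok t)"
  have "ok t"
    unfolding t_def using \<open>ok r\<close> by (rule LeastI)
  then obtain P Q where P: "P \<in> carrier_mat r r" and Q: "Q \<in> carrier_mat r r"
    and PQ: "P * Q = 1\<^sub>m r" and QP: "Q * P = 1\<^sub>m r" and "t \<le> r"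
    and N: "\<And>i. t \<le> i \<Longrightarrow> i < r \<Longrightarrow> col P i \<in> N"
    unfolding ok_def by blast
  have "c = 0\<^sub>v r"
    if c: "c \<in> carrier_vec r" and c0: "\<And>i. t \<le> i \<Longrightarrow> i < r \<Longrightarrow> c $ i = 0" and cN: "P *\<^sub>v c \<in> N" for c
  proof (rule ccontr)
    assume "c \<noteq> 0\<^sub>v r"
    then obtain j where j: "j < r" "c $ j \<noteq> 0"
      using c by (metis carrier_vecD eq_vecI index_zero_vec)
    then have "j < t" using c0 by (meson not_le)
    define m where "m = t - 1"
    have m: "m < r" "t = Suc m" using \<open>j < t\<close> \<open>t \<le> r\<close> by (auto simp: m_def)
    \<comment> \<open>Exchange matrix: column \<open>m\<close> is \<open>c\<close>, column
      \<open>j\<close> (if different) is the unit vector at \<open>m\<close>, the rest is the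
      identity. So \<open>P * A\<close> has \<open>P *\<^sub>v c\<close> as column \<open>m\<close>,
      and the old column \<open>m\<close> moves to position \<open>j\<close>. It is invertible since
      \<open>c $ j \<noteq> 0\<close>: row \<open>j\<close> of \<open>A *\<^sub>v d = 0\<close>
      gives \<open>d $ m = 0\<close>, and the other rows give the rest.\<close>
    define A where "A = mat r r (\<lambda>(i, k). if k = m then c $ i
      else if k = j then (if i = m then 1 else 0) else if i = k then 1 else 0)"
    have A: "A \<in> carrier_mat r r" by (simp add: A_def)
    have "det A \<noteq> 0"
    proof
      assume "det A = 0"
      then obtain d where d: "d \<in> carrier_vec r" "d \<noteq> 0\<^sub>v r" "A *\<^sub>v d = 0\<^sub>v r"
        using det_0_iff_vec_prod_zero_field[OF A] by blast
      have row: "c $ i * d $ m + (if i = j then 0 else if i = m then d $ j else d $ i) = 0"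
        if i: "i < r" for i
      proof -
        have "0 = (A *\<^sub>v d) $ i" using d i by simp
        also have "\<dots> = (\<Sum>k<r. A $$ (i, k) * d $ k)"
          using A d(1) i by (simp add: scalar_prod_def atLeast0LessThan)
        also have "\<dots> = (\<Sum>k<r. (if k = m then c $ i * d $ m else 0) +
            (if k = (if i = m then j else i) then (if i = j then 0 else d $ k) else 0))"
          by (rule sum.cong) (use i in \<open>auto simp: A_def\<close>)
        also have "\<dots> = c $ i * d $ m + (if i = j then 0 else if i = m then d $ j else d $ i)"
          using i j m by (simp add: sum.distrib)
        finally show ?thesis by simp
      qed
      have dm: "d $ m = 0" using row[OF \<open>j < r\<close>] j by simp
      have "d $ i = 0" if "i < r" for i
        using row[OF that] row[OF \<open>m < r\<close>] dm by (cases "i = j"; cases "m = j"; cases "i = m") auto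
      then show False using d by (metis carrier_vecD eq_vecI index_zero_vec)
    qed
    from det_non_zero_imp_unit[OF A this, of "()"]
    obtain B where B: "B \<in> carrier_mat r r" "B * A = 1\<^sub>m r" "A * B = 1\<^sub>m r"
      unfolding Units_def ring_mat_def by auto
    have "col (P * A) i \<in> N" if "m \<le> i" "i < r" for i
    proof -
      have col: "col (P * A) i = P *\<^sub>v col A i"
        using P A that by simp
      show ?thesis
      proof (cases "i = m")
        case True
        then have "col A i = c" using c that by (intro eq_vecI) (auto simp: A_def)
        then show ?thesis using cN col by simp
      next
        case False
        then have "i \<noteq> j" using that \<open>j < t\<close> m by auto
        then have "col A i = unit_vec r i"
          using False that by (intro eq_vecI) (auto simp: A_def)
        moreover have "P *\<^sub>v unit_vec r i = col P i"
          using P that by (intro eq_vecI) auto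
        ultimately show ?thesis using col that False N m by simp
      qed
    qed
    moreover have "(P * A) * (B * Q) = 1\<^sub>m r"
    proof -
      have "A * (B * Q) = Q"
        using assoc_mult_mat[OF A B(1) Q] B Q by simp
      then show ?thesis
        using assoc_mult_mat[OF P A, of "B * Q" r] B Q PQ by simp
    qed
    moreover have "(B * Q) * (P * A) = 1\<^sub>m r"
    proof -
      have "Q * (P * A) = A"
        using assoc_mult_mat[OF Q P A] A QP by simp
      then show ?thesis
        using assoc_mult_mat[OF B(1) Q, of "P * A" r] P A B by simp
    qed
    ultimately have "ok m"
      unfolding ok_def using P A B Q m
      by (intro exI[of _ "P * A"] exI[of _ "B * Q"]) auto
    then have "t \<le> m" unfolding t_def by (rule Least_le)
    then show False using m by simp
  qed
  then show thesis
    using that P Q PQ QP \<open>t \<le> r\<close> N by blast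
qed

subsection \<open>Extension of positive functionals\<close>

text \<open>Only closure under linear combinations is asked. Single-valuedness is derived later,
  from positivity at the zero function.\<close>

definition lin_graph :: "(('i \<Rightarrow> real) \<times> real) set \<Rightarrow> bool" where
  "lin_graph M \<longleftrightarrow> (\<forall>p h q k a b. (p, h) \<in> M \<longrightarrow> (q, k) \<in> M \<longrightarrow>
     ((\<lambda>i. a * p i + b * q i), a * h + b * k) \<in> M)"

lemma lin_graphD:
  "lin_graph M \<Longrightarrow> (p, h) \<in> M \<Longrightarrow> (q, k) \<in> M \<Longrightarrow> ((\<lambda>i. a * p i + b * q i), a * h + b * k) \<in> M"
  unfolding lin_graph_def by blast

text \<open>The extension theorem of M. Riesz for a cone \<open>C\<close>, where a functional on a subspace of
  \<open>'i \<Rightarrow> real\<close> is given by its graph \<open>M\<close>.\<close>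

lemma positive_extension_step:
  fixes M :: "(('i \<Rightarrow> real) \<times> real) set" and C :: "('i \<Rightarrow> real) set" and e :: "'i \<Rightarrow> real"
  assumes M: "lin_graph M"
    and add: "\<And>p q. p \<in> C \<Longrightarrow> q \<in> C \<Longrightarrow> (\<lambda>i. p i + q i) \<in> C"
    and scale: "\<And>a p. a > 0 \<Longrightarrow> p \<in> C \<Longrightarrow> (\<lambda>i. a * p i) \<in> C"
    and pos: "\<And>p h. (p, h) \<in> M \<Longrightarrow> p \<in> C \<Longrightarrow> h \<ge> 0"
    and up: "\<exists>(u, h) \<in> M. (\<lambda>i. u i + e i) \<in> C" and down: "\<exists>(u, h) \<in> M. (\<lambda>i. u i - e i) \<in> C"
  shows "\<exists>M'. M \<subseteq> M' \<and> lin_graph M' \<and> (\<forall>(p, h) \<in> M'. p \<in> C \<longrightarrow> h \<ge> 0) \<and> (\<exists>\<alpha>. (e, \<alpha>) \<in> M')"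
proof -
  \<comment> \<open>If \<open>p + e\<close> lies in \<open>C\<close>, the value at \<open>e\<close>
    has to be at least \<open>- h\<close>; if \<open>q - e\<close> does, at most \<open>k\<close>.
    \<open>A\<close> collects the lower bounds, and \<open>le\<close> puts each of them below each
    upper bound.\<close>
  define A where "A = {- h | p h. (p, h) \<in> M \<and> (\<lambda>i. p i + e i) \<in> C}"
  have le: "- h \<le> k" if "(p, h) \<in> M" "(\<lambda>i. p i + e i) \<in> C" "(q, k) \<in> M" "(\<lambda>i. q i - e i) \<in> C"
    for p h q k
  proof -
    have "(\<lambda>i. 1 * p i + 1 * q i) \<in> C"
      using add[OF that(2,4)] by simp
    then show ?thesis
      using pos[OF lin_graphD[OF M that(1,3), of 1 1]] by simp
  qed
  have "A \<noteq> {}" using up by (auto simp: A_def)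
  obtain q0 k0 where q0: "(q0, k0) \<in> M" "(\<lambda>i. q0 i - e i) \<in> C" using down by auto
  have bdd: "bdd_above A"
    unfolding bdd_above_def A_def using le q0 by blast
  define \<alpha> where "\<alpha> = Sup A"
  have lo: "- h \<le> \<alpha>" if "(p, h) \<in> M" "(\<lambda>i. p i + e i) \<in> C" for p h
    unfolding \<alpha>_def using that by (intro cSup_upper bdd) (auto simp: A_def)
  have hi: "\<alpha> \<le> k" if "(q, k) \<in> M" "(\<lambda>i. q i - e i) \<in> C" for q k
    unfolding \<alpha>_def using that le by (intro cSup_least \<open>A \<noteq> {}\<close>) (auto simp: A_def)
  define M' where "M' = {((\<lambda>i. p i + c * e i), h + c * \<alpha>) | p h c. (p, h) \<in> M}"
  have "M \<subseteq> M'"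
  proof
    fix x assume "x \<in> M"
    then show "x \<in> M'"
      unfolding M'_def by (cases x, intro CollectI exI[of _ "fst x"] exI[of _ "snd x"] exI[of _ 0]) auto
  qed
  moreover have "lin_graph M'"
    unfolding lin_graph_def
  proof (intro allI impI)
    fix p h q k a b assume "(p, h) \<in> M'" "(q, k) \<in> M'"
    then obtain p' h' c q' k' d where *: "(p', h') \<in> M" "(q', k') \<in> M"
      "p = (\<lambda>i. p' i + c * e i)" "h = h' + c * \<alpha>" "q = (\<lambda>i. q' i + d * e i)" "k = k' + d * \<alpha>"
      unfolding M'_def by blast
    show "((\<lambda>i. a * p i + b * q i), a * h + b * k) \<in> M'"
      unfolding M'_def mem_Collect_eq
      by (rule exI[of _ "\<lambda>i. a * p' i + b * q' i"], rule exI[of _ "a * h' + b * k'"],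
          rule exI[of _ "a * c + b * d"])
        (use lin_graphD[OF M *(1,2)] in \<open>auto simp: *(3-6) algebra_simps\<close>)
  qed
  moreover have "h \<ge> 0" if M': "(p, h) \<in> M'" and "p \<in> C" for p h
  proof -
    obtain q k c where q: "(q, k) \<in> M" "p = (\<lambda>i. q i + c * e i)" "h = k + c * \<alpha>"
      using M' unfolding M'_def by blast
    \<comment> \<open>Division by the absolute value of \<open>c\<close> makes the coefficient of
      \<open>e\<close> equal to 1 or -1, where \<open>lo\<close> or \<open>hi\<close>
      applies.\<close>
    show ?thesis
    proof (cases c "0::real" rule: linorder_cases)
      case equal
      then show ?thesis using q pos that by simp
    next
      case greater
      have "((\<lambda>i. (1/c) * q i + 0 * q i), (1/c) * k + 0 * k) \<in> M"
        by (rule lin_graphD[OF M q(1) q(1)])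
      moreover have "(\<lambda>i. (1/c) * p i) \<in> C"
        using scale[of "1/c" p] greater that by simp
      moreover have "(1/c) * p i = ((1/c) * q i + 0 * q i) + e i" for i
        using greater by (simp add: q field_simps)
      ultimately have "- ((1/c) * k + 0 * k) \<le> \<alpha>"
        using lo by simp
      then show ?thesis using greater by (simp add: q field_simps)
    next
      case less
      have "((\<lambda>i. (1/-c) * q i + 0 * q i), (1/-c) * k + 0 * k) \<in> M"
        by (rule lin_graphD[OF M q(1) q(1)])
      moreover have "(\<lambda>i. (1/-c) * p i) \<in> C"
        using scale[of "1/-c" p] less that by simp
      moreover have "(1/-c) * p i = ((1/-c) * q i + 0 * q i) - e i" for i
        using less by (simp add: q field_simps)
      ultimately have "\<alpha> \<le> (1/-c) * k + 0 * k"
        using hi by simp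
      then show ?thesis using less by (simp add: q field_simps)
    qed
  qed
  moreover have "\<exists>\<alpha>. (e, \<alpha>) \<in> M'"
  proof -
    obtain u h where "(u, h) \<in> M" using up by auto
    then have "((\<lambda>i. 0 * u i + 0 * u i), 0 * h + 0 * h) \<in> M" by (intro lin_graphD[OF M])
    then have "((\<lambda>i. 0), 0) \<in> M" by simp
    then show ?thesis
      unfolding M'_def by (intro exI[of _ \<alpha>] CollectI exI[of _ "\<lambda>_. 0"] exI[of _ 0] exI[of _ 1]) auto
  qed
  ultimately show ?thesis by blast
qed

text \<open>One unit vector is adjoined at a time, so finitely many extension steps suffice;
  \<open>up\<close> and \<open>down\<close> persist because the graph only grows.\<close>

lemma positive_extension:
  fixes M :: "(('i \<Rightarrow> real) \<times> real) set" and C :: "('i \<Rightarrow> real) set"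
  assumes "finite I" and M: "lin_graph M"
    and add: "\<And>p q. p \<in> C \<Longrightarrow> q \<in> C \<Longrightarrow> (\<lambda>i. p i + q i) \<in> C"
    and scale: "\<And>a p. a > 0 \<Longrightarrow> p \<in> C \<Longrightarrow> (\<lambda>i. a * p i) \<in> C"
    and pos: "\<forall>(p, h) \<in> M. p \<in> C \<longrightarrow> h \<ge> 0"
    and up: "\<And>k. k \<in> I \<Longrightarrow> \<exists>(u, h) \<in> M. (\<lambda>i. u i + of_bool (i = k)) \<in> C"
    and down: "\<And>k. k \<in> I \<Longrightarrow> \<exists>(u, h) \<in> M. (\<lambda>i. u i - of_bool (i = k)) \<in> C"
  shows "\<exists>M'. M \<subseteq> M' \<and> lin_graph M' \<and> (\<forall>(p, h) \<in> M'. p \<in> C \<longrightarrow> h \<ge> 0) \<and>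
    (\<forall>k \<in> I. \<exists>\<alpha>. ((\<lambda>i. of_bool (i = k)), \<alpha>) \<in> M')"
  using \<open>finite I\<close> up down
proof (induction I)
  case empty
  then show ?case using M pos by (intro exI[of _ M]) auto
next
  case (insert k I)
  have "\<exists>M'. M \<subseteq> M' \<and> lin_graph M' \<and> (\<forall>(p, h) \<in> M'. p \<in> C \<longrightarrow> h \<ge> 0) \<and>
    (\<forall>k \<in> I. \<exists>\<alpha>. ((\<lambda>i. of_bool (i = k)), \<alpha>) \<in> M')"
    by (rule insert.IH; rule insert.prems; simp)
  then obtain M1 where M1: "M \<subseteq> M1" "lin_graph M1" "\<forall>(p, h) \<in> M1. p \<in> C \<longrightarrow> h \<ge> 0"
    "\<forall>k \<in> I. \<exists>\<alpha>. ((\<lambda>i. of_bool (i = k)), \<alpha>) \<in> M1"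
    by (elim exE conjE)
  have "\<exists>M'. M1 \<subseteq> M' \<and> lin_graph M' \<and> (\<forall>(p, h) \<in> M'. p \<in> C \<longrightarrow> h \<ge> 0) \<and>
      (\<exists>\<alpha>. ((\<lambda>i. of_bool (i = k)), \<alpha>) \<in> M')"
  proof (rule positive_extension_step[OF M1(2) add scale])
    show "\<exists>(u, h) \<in> M1. (\<lambda>i. u i + of_bool (i = k)) \<in> C"
      using insert.prems(1)[of k] M1(1) by blast
    show "\<exists>(u, h) \<in> M1. (\<lambda>i. u i - of_bool (i = k)) \<in> C"
      using insert.prems(2)[of k] M1(1) by blast
    show "\<And>p h. (p, h) \<in> M1 \<Longrightarrow> p \<in> C \<Longrightarrow> h \<ge> 0"
      using M1(3) by blast
  qed
  then obtain M' where "M1 \<subseteq> M'" "lin_graph M'" "\<forall>(p, h) \<in> M'. p \<in> C \<longrightarrow> h \<ge> 0"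
    "\<exists>\<alpha>. ((\<lambda>i. of_bool (i = k)), \<alpha>) \<in> M'" by blast
  note M' = this
  have ext: "\<exists>\<alpha>. ((\<lambda>i. of_bool (i = l)), \<alpha>) \<in> M'" if "l \<in> insert k I" for l
  proof (cases "l = k")
    case False
    then have "l \<in> I" using that by simp
    then obtain \<alpha> where "((\<lambda>i. of_bool (i = l)), \<alpha>) \<in> M1"
      by (rule exE[OF M1(4)[rule_format, of l]])
    with M'(1) have "((\<lambda>i. of_bool (i = l)), \<alpha>) \<in> M'" by (rule subsetD)
    then show ?thesis ..
  qed (use M'(4) in simp)
  have "M \<subseteq> M'" using M1(1) M'(1) by (rule order_trans)
  moreover have "\<forall>k \<in> insert k I. \<exists>\<alpha>. ((\<lambda>i. of_bool (i = k)), \<alpha>) \<in> M'"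
    by (rule ballI) (rule ext)
  ultimately show ?case
    using M'(2,3) by (intro exI[of _ M'] conjI)
qed

text \<open>The weights \<open>w\<close> are the values of the extended functional at the unit
  vectors, of which every function supported on \<open>I\<close> is a combination.\<close>

lemma positive_functional:
  fixes M :: "(('i \<Rightarrow> real) \<times> real) set" and C :: "('i \<Rightarrow> real) set"
  assumes fin: "finite I" and M: "lin_graph M"
    and add: "\<And>p q. p \<in> C \<Longrightarrow> q \<in> C \<Longrightarrow> (\<lambda>i. p i + q i) \<in> C"
    and scale: "\<And>a p. a > 0 \<Longrightarrow> p \<in> C \<Longrightarrow> (\<lambda>i. a * p i) \<in> C"
    and zero: "(\<lambda>i. 0) \<in> C"
    and pos: "\<forall>(p, h) \<in> M. p \<in> C \<longrightarrow> h \<ge> 0"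
    and up: "\<And>k. k \<in> I \<Longrightarrow> \<exists>(u, h) \<in> M. (\<lambda>i. u i + of_bool (i = k)) \<in> C"
    and down: "\<And>k. k \<in> I \<Longrightarrow> \<exists>(u, h) \<in> M. (\<lambda>i. u i - of_bool (i = k)) \<in> C"
    and ne: "M \<noteq> {}"
  obtains w where "\<And>p h. (p, h) \<in> M \<Longrightarrow> (\<And>i. i \<notin> I \<Longrightarrow> p i = 0) \<Longrightarrow> h = (\<Sum>i\<in>I. w i * p i)"
    and "\<And>p. p \<in> C \<Longrightarrow> (\<And>i. i \<notin> I \<Longrightarrow> p i = 0) \<Longrightarrow> (\<Sum>i\<in>I. w i * p i) \<ge> 0"
proof -
  have "\<exists>M'. M \<subseteq> M' \<and> lin_graph M' \<and> (\<forall>(p, h) \<in> M'. p \<in> C \<longrightarrow> h \<ge> 0) \<and>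
    (\<forall>k \<in> I. \<exists>\<alpha>. ((\<lambda>i. of_bool (i = k)), \<alpha>) \<in> M')"
    by (rule positive_extension[OF fin M _ _ pos]) (rule add scale up down; assumption)+
  then obtain M' where M': "M \<subseteq> M'" "lin_graph M'" "\<forall>(p, h) \<in> M'. p \<in> C \<longrightarrow> h \<ge> 0"
    "\<forall>k \<in> I. \<exists>\<alpha>. ((\<lambda>i. of_bool (i = k)), \<alpha>) \<in> M'"
    by (elim exE conjE)
  obtain w where w: "\<And>k. k \<in> I \<Longrightarrow> ((\<lambda>i. of_bool (i = k)), w k) \<in> M'"
    using M'(4) by metis
  obtain u h where "(u, h) \<in> M'" using ne M'(1) by auto
  from lin_graphD[OF M'(2) this this, of 0 0] have M'0: "((\<lambda>i. 0), 0) \<in> M'" by simp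
  have in_M': "((\<lambda>i. if i \<in> J then p i else 0), (\<Sum>i\<in>J. w i * p i)) \<in> M'"
    if "finite J" "J \<subseteq> I" for J and p :: "'i \<Rightarrow> real"
    using that
  proof (induction J)
    case (insert k J)
    then have "((\<lambda>i. 1 * (if i \<in> J then p i else 0) + p k * of_bool (i = k)),
        1 * (\<Sum>i\<in>J. w i * p i) + p k * w k) \<in> M'"
      using w by (intro lin_graphD[OF M'(2)]) auto
    moreover have "(\<lambda>i. 1 * (if i \<in> J then p i else 0) + p k * of_bool (i = k)) =
        (\<lambda>i. if i \<in> insert k J then p i else 0)"
      using insert.hyps by auto
    ultimately show ?case
      using insert.hyps by (simp add: algebra_simps)
  qed (use M'0 in simp)
  have p_in: "(p, \<Sum>i\<in>I. w i * p i) \<in> M'" if "\<And>i. i \<notin> I \<Longrightarrow> p i = 0" for p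
  proof -
    have "(\<lambda>i. if i \<in> I then p i else 0) = p" using that by auto
    then show ?thesis using in_M'[OF fin, of p] by simp
  qed
  show thesis
  proof
    fix p h assume p: "(p, h) \<in> M" "\<And>i. i \<notin> I \<Longrightarrow> p i = 0"
    let ?s = "\<Sum>i\<in>I. w i * p i"
    \<comment> \<open>Two values at the same \<open>p\<close> differ by a value at zero, which lies
      in \<open>C\<close>; positivity for \<open>a = 1\<close> and \<open>a = -1\<close> makes them
      equal.\<close>
    have "((\<lambda>i. a * p i + - a * p i), a * h + - a * ?s) \<in> M'" for a
      using M'(1) p p_in by (intro lin_graphD[OF M'(2)]) auto
    then have "a * h + - a * ?s \<ge> 0" for a
      using M'(3) zero by fastforce
    from this[of 1] this[of "-1"] show "h = ?s" by simp
  next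
    fix p assume "p \<in> C" "\<And>i. i \<notin> I \<Longrightarrow> p i = 0"
    then show "(\<Sum>i\<in>I. w i * p i) \<ge> 0"
      using M'(3) p_in by blast
  qed
qed

subsection \<open>Semidefinite formulations\<close>

definition feasible ::
  "('a::euclidean_space \<times> real mat \<times> real) set \<Rightarrow> nat \<Rightarrow> 'a \<Rightarrow> real mat \<Rightarrow> bool" where
  "feasible S r x Y \<longleftrightarrow> Y \<in> psd_matrices r \<and> (\<forall>(a, U, b) \<in> S. inner a x + frobenius_inner U Y = b)"

definition sdp_form :: "('a::euclidean_space \<times> real mat \<times> real) set \<Rightarrow> nat \<Rightarrow> 'a set \<Rightarrow> bool" where
  "sdp_form S r K \<longleftrightarrow>
     (\<forall>(a, U, b) \<in> S. U \<in> psd_matrices r) \<and> (\<forall>x. x \<in> K \<longleftrightarrow> (\<exists>Y. feasible S r x Y))"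

lemma has_sdp_formulation_iff: "has_sdp_formulation K r \<longleftrightarrow> (\<exists>S. sdp_form S r K)"
  by (simp add: has_sdp_formulation_def sdp_form_def feasible_def Bex_def)

lemma sdp_formD:
  assumes "sdp_form S r K"
  shows "(a, U, b) \<in> S \<Longrightarrow> U \<in> psd_matrices r"
    and "feasible S r x Y \<Longrightarrow> x \<in> K"
    and "x \<in> K \<Longrightarrow> \<exists>Y. feasible S r x Y"
  using assms by (auto simp: sdp_form_def)

lemma feasibleD:
  assumes "feasible S r x Y"
  shows "Y \<in> psd_matrices r" and "(a, U, b) \<in> S \<Longrightarrow> inner a x + frobenius_inner U Y = b"
  using assms by (auto simp: feasible_def)

text \<open>The family obtained by substituting \<open>congruence Q Y\<close> for \<open>Y\<close>,
  with the substitution moved to the coefficients, which stay psd.\<close>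

definition transform_form ::
  "real mat \<Rightarrow> ('a \<times> real mat \<times> real) set \<Rightarrow> ('a \<times> real mat \<times> real) set" where
  "transform_form Q S = (\<lambda>(a, U, b). (a, congruence (transpose_mat Q) U, b)) ` S"

lemma feasible_transform_form:
  assumes S: "\<forall>(a, U, b) \<in> S. U \<in> psd_matrices r"
    and Q: "Q \<in> carrier_mat r r" and Y: "Y \<in> psd_matrices r"
  shows "feasible (transform_form Q S) r x Y \<longleftrightarrow> feasible S r x (congruence Q Y)"
proof -
  have "frobenius_inner (congruence (transpose_mat Q) U) Y = frobenius_inner U (congruence Q Y)"
    if "(a, U, b) \<in> S" for a U b
    using S that Q Y by (intro frobenius_inner_congruence[of _ r]) (auto intro: psd_carrier)
  then show ?thesis
    using Y congruence_psd[OF Q Y] unfolding feasible_def transform_form_def by fastforce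
qed

lemma sdp_form_transform_form:
  assumes S: "sdp_form S r K" and P: "P \<in> carrier_mat r r" and Q: "Q \<in> carrier_mat r r"
    and PQ: "P * Q = 1\<^sub>m r"
  shows "sdp_form (transform_form Q S) r K"
proof -
  have psd: "\<forall>(a, U, b) \<in> S. U \<in> psd_matrices r" using S by (simp add: sdp_form_def)
  have "\<forall>(a, U, b) \<in> transform_form Q S. U \<in> psd_matrices r"
    using psd Q by (auto simp: transform_form_def intro!: congruence_psd)
  moreover have "(\<exists>Y. feasible (transform_form Q S) r x Y) \<longleftrightarrow> (\<exists>Y. feasible S r x Y)" for x
  proof
    assume "\<exists>Y. feasible (transform_form Q S) r x Y"
    then show "\<exists>Y. feasible S r x Y"
      using feasible_transform_form[OF psd Q] feasibleD(1) by blast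
  next
    assume "\<exists>Y. feasible S r x Y"
    then obtain Y where Y: "feasible S r x Y" by blast
    have "congruence Q (congruence P Y) = Y"
      using P Q PQ feasibleD(1)[OF Y] by (intro congruence_inverse) (auto intro: psd_carrier)
    then have "feasible (transform_form Q S) r x (congruence P Y)"
      using feasible_transform_form[OF psd Q congruence_psd[OF P feasibleD(1)[OF Y]]] Y by simp
    then show "\<exists>Y. feasible (transform_form Q S) r x Y" by blast
  qed
  ultimately show ?thesis
    using S unfolding sdp_form_def by simp
qed

section \<open>Diagonal blocks, padding and bordering\<close>

definition diag_block :: "nat \<Rightarrow> nat \<Rightarrow> real mat \<Rightarrow> real mat" where
  "diag_block k n A = mat n n (\<lambda>(i, j). A $$ (k + i, k + j))"

definition pad_zero :: "nat \<Rightarrow> nat \<Rightarrow> real mat \<Rightarrow> real mat" where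
  "pad_zero n r A = mat r r (\<lambda>(i, j). if i < n \<and> j < n then A $$ (i, j) else 0)"

definition add_corner :: "nat \<Rightarrow> real mat \<Rightarrow> real \<Rightarrow> real mat" where
  "add_corner n A y = mat (Suc n) (Suc n)
     (\<lambda>(i, j). if i < n \<and> j < n then A $$ (i, j) else if i = j then y else 0)"

lemma sum_restrict_block:
  fixes g :: "nat \<Rightarrow> 'a::comm_monoid_add"
  assumes "k + n \<le> r" and "\<And>i. i < r \<Longrightarrow> i < k \<or> k + n \<le> i \<Longrightarrow> g i = 0"
  shows "(\<Sum>i<r. g i) = (\<Sum>i<n. g (k + i))"
proof -
  have "(\<Sum>i<r. g i) = (\<Sum>i\<in>{k..<k+n}. g i)"
    by (rule sum.mono_neutral_right) (use assms in auto)
  also have "\<dots> = (\<Sum>i<n. g (k + i))"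
    by (rule sum.reindex_bij_witness[of _ "\<lambda>i. k + i" "\<lambda>i. i - k"]) auto
  finally show ?thesis .
qed

lemma double_sum_restrict_block:
  fixes g :: "nat \<Rightarrow> nat \<Rightarrow> 'a::comm_monoid_add"
  assumes "k + n \<le> r"
    and "\<And>i j. i < r \<Longrightarrow> j < r \<Longrightarrow> i < k \<or> k + n \<le> i \<or> j < k \<or> k + n \<le> j \<Longrightarrow> g i j = 0"
  shows "(\<Sum>i<r. \<Sum>j<r. g i j) = (\<Sum>i<n. \<Sum>j<n. g (k + i) (k + j))"
proof -
  have "(\<Sum>i<r. \<Sum>j<r. g i j) = (\<Sum>i<n. \<Sum>j<r. g (k + i) j)"
    by (rule sum_restrict_block) (use assms in auto)
  also have "\<dots> = (\<Sum>i<n. \<Sum>j<n. g (k + i) (k + j))"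
    by (intro sum.cong refl sum_restrict_block) (use assms in auto)
  finally show ?thesis .
qed

lemma diag_block_psd:
  assumes "A \<in> psd_matrices r" "k + n \<le> r"
  shows "diag_block k n A \<in> psd_matrices n"
proof -
  have "bil_form n (diag_block k n A) v v \<ge> 0" for v
  proof -
    define w where "w = (\<lambda>i. if k \<le> i \<and> i < k + n then v (i - k) else 0)"
    have "bil_form r A w w = (\<Sum>i<n. \<Sum>j<n. A $$ (k + i, k + j) * w (k + i) * w (k + j))"
      unfolding bil_form_def
      by (rule double_sum_restrict_block[OF assms(2)]) (auto simp: w_def)
    also have "\<dots> = bil_form n (diag_block k n A) v v"
      by (simp add: bil_form_def diag_block_def w_def)
    finally show ?thesis using psd_nonneg[OF assms(1), of w] by simp
  qed
  moreover have "diag_block k n A $$ (i, j) = diag_block k n A $$ (j, i)" if "i < n" "j < n" for i j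
    using that psd_sym[OF assms(1), of "k + i" "k + j"] assms(2) by (simp add: diag_block_def)
  ultimately show ?thesis
    by (intro psdI) (auto simp: diag_block_def)
qed

lemma pad_zero_psd:
  assumes "A \<in> psd_matrices n" "n \<le> r"
  shows "pad_zero n r A \<in> psd_matrices r"
proof -
  have "bil_form r (pad_zero n r A) v v = bil_form n A v v" for v
  proof -
    have "bil_form r (pad_zero n r A) v v =
        (\<Sum>i<n. \<Sum>j<n. pad_zero n r A $$ (0 + i, 0 + j) * v (0 + i) * v (0 + j))"
      unfolding bil_form_def
      by (rule double_sum_restrict_block) (use assms(2) in \<open>auto simp: pad_zero_def\<close>)
    then show ?thesis
      using assms(2) by (simp add: bil_form_def pad_zero_def)
  qed
  moreover have "pad_zero n r A $$ (i, j) = pad_zero n r A $$ (j, i)" if "i < r" "j < r" for i j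
    using that psd_sym[OF assms(1), of i j] by (simp add: pad_zero_def)
  ultimately show ?thesis
    using psd_nonneg[OF assms(1)] by (intro psdI) (auto simp: pad_zero_def)
qed

lemma add_corner_psd_iff:
  assumes "A \<in> carrier_mat n n"
  shows "add_corner n A y \<in> psd_matrices (Suc n) \<longleftrightarrow> A \<in> psd_matrices n \<and> y \<ge> 0"
proof -
  have form: "bil_form (Suc n) (add_corner n A y) v v = bil_form n A v v + y * (v n)\<^sup>2" for v
    by (simp add: bil_form_def add_corner_def power2_eq_square)
  have "(\<forall>v. bil_form n A v v + y * (v n)\<^sup>2 \<ge> 0) \<longleftrightarrow> (\<forall>v. bil_form n A v v \<ge> 0) \<and> y \<ge> 0"
  proof (intro iffI conjI allI)
    fix v assume *: "\<forall>v. bil_form n A v v + y * (v n)\<^sup>2 \<ge> 0"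
    have "bil_form n A (v(n := 0)) (v(n := 0)) = bil_form n A v v"
      by (rule bil_form_cong) auto
    then show "bil_form n A v v \<ge> 0"
      using *[rule_format, of "v(n := 0)"] by simp
    show "y \<ge> 0"
      using *[rule_format, of "\<lambda>i. if i = n then 1 else 0"] by (simp add: bil_form_def)
  qed simp
  moreover have "(\<forall>i<Suc n. \<forall>j<Suc n. add_corner n A y $$ (i, j) = add_corner n A y $$ (j, i)) \<longleftrightarrow>
      (\<forall>i<n. \<forall>j<n. A $$ (i, j) = A $$ (j, i))"
    unfolding add_corner_def by (auto simp: less_Suc_eq)
  moreover have "add_corner n A y \<in> carrier_mat (Suc n) (Suc n)"
    by (simp add: add_corner_def)
  ultimately show ?thesis
    using assms unfolding psd_iff form by blast
qed

lemma frobenius_inner_add_corner: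
  assumes "Z \<in> carrier_mat (Suc n) (Suc n)"
  shows "frobenius_inner (add_corner n A y) Z =
    frobenius_inner (diag_block 0 n A) (diag_block 0 n Z) + y * Z $$ (n, n)"
  by (simp add: frobenius_inner_def add_corner_def diag_block_def)

text \<open>Facial reduction: vanishing diagonal entries kill whole rows and columns, so the
  equations see only the leading block; padding with zeros gives the converse.\<close>

lemma has_sdp_formulation_restrict:
  assumes S: "sdp_form S r K" and "t \<le> r"
    and zero: "\<And>x Y i. feasible S r x Y \<Longrightarrow> t \<le> i \<Longrightarrow> i < r \<Longrightarrow> Y $$ (i, i) = 0"
  shows "has_sdp_formulation K t"
proof -
  define S' where "S' = (\<lambda>(a, U, b). (a, diag_block 0 t U, b)) ` S"
  have inner_eq: "frobenius_inner U Y = frobenius_inner (diag_block 0 t U) (diag_block 0 t Y)"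
    if "U \<in> psd_matrices r" "\<And>i j. i < r \<Longrightarrow> j < r \<Longrightarrow> t \<le> i \<or> t \<le> j \<Longrightarrow> Y $$ (i, j) = 0" for U Y
  proof -
    have "frobenius_inner U Y = (\<Sum>i<t. \<Sum>j<t. U $$ (0 + i, 0 + j) * Y $$ (0 + i, 0 + j))"
      unfolding frobenius_inner_carrier[OF psd_carrier[OF that(1)]]
      by (rule double_sum_restrict_block) (use \<open>t \<le> r\<close> that(2) in auto)
    then show ?thesis by (simp add: frobenius_inner_def diag_block_def)
  qed
  have "sdp_form S' t K"
    unfolding sdp_form_def
  proof (intro conjI allI iffI)
    show "\<forall>(a, U, b) \<in> S'. U \<in> psd_matrices t"
      using sdp_formD(1)[OF S] \<open>t \<le> r\<close> by (auto simp: S'_def intro!: diag_block_psd[of _ r])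
  next
    fix x assume "x \<in> K"
    then obtain Y where Y: "feasible S r x Y" using sdp_formD(3)[OF S] by blast
    have Y0: "Y $$ (i, j) = 0" if "i < r" "j < r" "t \<le> i \<or> t \<le> j" for i j
      using that zero[OF Y] psd_diag_zero[OF feasibleD(1)[OF Y]] by blast
    have "inner a x + frobenius_inner (diag_block 0 t U) (diag_block 0 t Y) = b" if "(a, U, b) \<in> S" for a U b
      using feasibleD(2)[OF Y that] inner_eq[OF sdp_formD(1)[OF S that] Y0] by simp
    then have "feasible S' t x (diag_block 0 t Y)"
      using diag_block_psd[OF feasibleD(1)[OF Y], of 0 t] \<open>t \<le> r\<close>
      unfolding feasible_def S'_def by auto
    then show "\<exists>Y. feasible S' t x Y" by blast
  next
    fix x assume "\<exists>Y. feasible S' t x Y"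
    then obtain V where V: "feasible S' t x V" by blast
    define Y where "Y = pad_zero t r V"
    have "V \<in> carrier_mat t t" using feasibleD(1)[OF V] by (rule psd_carrier)
    then have VY: "diag_block 0 t Y = V"
      unfolding Y_def diag_block_def pad_zero_def using \<open>t \<le> r\<close> by (intro eq_matI) auto
    have "inner a x + frobenius_inner U Y = b" if "(a, U, b) \<in> S" for a U b
    proof -
      have "(a, diag_block 0 t U, b) \<in> S'" unfolding S'_def using that by force
      moreover have "frobenius_inner U Y = frobenius_inner (diag_block 0 t U) (diag_block 0 t Y)"
        by (rule inner_eq[OF sdp_formD(1)[OF S that]]) (auto simp: Y_def pad_zero_def)
      ultimately show ?thesis
        using feasibleD(2)[OF V] VY by simp
    qed
    then have "feasible S r x Y"
      using pad_zero_psd[OF feasibleD(1)[OF V] \<open>t \<le> r\<close>] unfolding feasible_def Y_def by blast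
    then show "x \<in> K" by (rule sdp_formD(2)[OF S])
  qed
  then show ?thesis unfolding has_sdp_formulation_iff by blast
qed

section \<open>Averaging and positive definite feasible matrices\<close>

definition mat_comb :: "nat \<Rightarrow> real \<Rightarrow> real mat \<Rightarrow> real \<Rightarrow> real mat \<Rightarrow> real mat" where
  "mat_comb r a A b B = mat r r (\<lambda>(i, j). a * A $$ (i, j) + b * B $$ (i, j))"

lemma bil_form_mat_comb:
  "bil_form r (mat_comb r a A b B) u v = a * bil_form r A u v + b * bil_form r B u v"
  by (simp add: bil_form_def mat_comb_def sum_distrib_left sum.distrib algebra_simps)

lemma frobenius_inner_mat_comb:
  "U \<in> carrier_mat r r \<Longrightarrow>
    frobenius_inner U (mat_comb r a A b B) = a * frobenius_inner U A + b * frobenius_inner U B"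
  by (simp add: frobenius_inner_carrier mat_comb_def sum_distrib_left sum.distrib algebra_simps)

lemma mat_comb_psd:
  assumes "A \<in> psd_matrices r" "B \<in> psd_matrices r" "a \<ge> 0" "b \<ge> 0"
  shows "mat_comb r a A b B \<in> psd_matrices r"
proof (rule psdI)
  show "mat_comb r a A b B $$ (i, j) = mat_comb r a A b B $$ (j, i)" if "i < r" "j < r" for i j
    using that psd_sym[OF assms(1), of i j] psd_sym[OF assms(2), of i j] by (simp add: mat_comb_def)
  show "bil_form r (mat_comb r a A b B) v v \<ge> 0" for v
    using assms psd_nonneg by (simp add: bil_form_mat_comb)
qed (simp add: mat_comb_def)

lemma feasible_convex:
  assumes S: "\<forall>(a, U, b) \<in> S. U \<in> psd_matrices r"
    and 1: "feasible S r x1 Y1" and 2: "feasible S r x2 Y2" and "a \<ge> 0" "b \<ge> 0" "a + b = 1"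
  shows "feasible S r (a *\<^sub>R x1 + b *\<^sub>R x2) (mat_comb r a Y1 b Y2)"
  unfolding feasible_def
proof (intro conjI ballI, goal_cases)
  case 1
  show ?case using assms feasibleD(1) mat_comb_psd by blast
next
  case (2 y)
  obtain g U d where y: "y = (g, U, d)" by (cases y)
  have "U \<in> carrier_mat r r" using S 2 y psd_carrier by blast
  then have "inner g (a *\<^sub>R x1 + b *\<^sub>R x2) + frobenius_inner U (mat_comb r a Y1 b Y2) =
      a * (inner g x1 + frobenius_inner U Y1) + b * (inner g x2 + frobenius_inner U Y2)"
    by (simp add: frobenius_inner_mat_comb inner_add_right algebra_simps)
  also have "\<dots> = (a + b) * d"
    using feasibleD(2)[OF assms(2)] feasibleD(2)[OF assms(3)] 2 y by (simp add: algebra_simps)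
  finally show ?case using y \<open>a + b = 1\<close> by simp
qed

text \<open>Used together with membership in \<open>psd_matrices r\<close>: the form is then
  nonnegative, and positive definiteness only has to exclude nontrivial zeros.\<close>

definition pos_def :: "nat \<Rightarrow> real mat \<Rightarrow> bool" where
  "pos_def r Y \<longleftrightarrow> (\<forall>u. bil_form r Y u u = 0 \<longrightarrow> (\<forall>i<r. u i = 0))"

text \<open>Positive definiteness is achieved one coordinate at a time: the form of \<open>Y\<close> restricted to the
  first \<open>k + 1\<close> coordinates has a kernel of dimension at most one, and averaging \<open>Y\<close> with a member
  of \<open>F\<close> that is positive on this kernel removes it.\<close>

lemma pos_def_of_family:
  assumes psd: "F \<subseteq> psd_matrices r" and "F \<noteq> {}"
    and avg: "\<And>Y Z. Y \<in> F \<Longrightarrow> Z \<in> F \<Longrightarrow> mat_comb r (1/2) Y (1/2) Z \<in> F"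
    and sep: "\<And>u. (\<forall>Y \<in> F. bil_form r Y u u = 0) \<Longrightarrow> \<forall>i<r. u i = 0"
  shows "\<exists>Y \<in> F. pos_def r Y"
proof -
  have "\<exists>Y \<in> F. \<forall>u. (\<forall>i<r. k \<le> i \<longrightarrow> u i = 0) \<longrightarrow> bil_form r Y u u = 0 \<longrightarrow> (\<forall>i<r. u i = 0)"
    if "k \<le> r" for k
    using that
  proof (induction k)
    case 0
    then show ?case using \<open>F \<noteq> {}\<close> by auto
  next
    case (Suc k)
    then obtain Y where Y: "Y \<in> F"
      "\<And>u. (\<forall>i<r. k \<le> i \<longrightarrow> u i = 0) \<Longrightarrow> bil_form r Y u u = 0 \<Longrightarrow> \<forall>i<r. u i = 0"
      by auto
    have Yp: "Y \<in> psd_matrices r" using Y psd by blast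
    show ?case
    proof (rule ccontr)
      assume no: "\<not> ?case"
      then obtain u i where u: "\<forall>i<r. Suc k \<le> i \<longrightarrow> u i = 0" "bil_form r Y u u = 0" "i < r" "u i \<noteq> 0"
        using Y(1) by blast
      have "u k \<noteq> 0"
      proof
        assume "u k = 0"
        then have "\<forall>i<r. k \<le> i \<longrightarrow> u i = 0" using u(1) by (metis le_eq_less_or_eq Suc_leI)
        then show False using Y(2) u by blast
      qed
      obtain Z where Z: "Z \<in> F" "bil_form r Z u u \<noteq> 0" using sep u by blast
      have Zp: "Z \<in> psd_matrices r" using Z psd by blast
      let ?X = "mat_comb r (1/2) Y (1/2) Z"
      have "\<forall>i<r. w i = 0" if w: "\<forall>i<r. Suc k \<le> i \<longrightarrow> w i = 0" "bil_form r ?X w w = 0" for w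
      proof -
        have Yw: "bil_form r Y w w = 0" and Zw: "bil_form r Z w w = 0"
          using w(2) psd_nonneg[OF Yp, of w] psd_nonneg[OF Zp, of w]
          by (auto simp: bil_form_mat_comb)
        \<comment> \<open>Cancels coordinate \<open>k\<close> of \<open>w - c u\<close>. As
          \<open>w\<close> and \<open>u\<close> are both isotropic for \<open>Y\<close>, so is the
          difference, and the choice of \<open>Y\<close> makes it zero; hence \<open>w\<close> is a
          multiple of \<open>u\<close>, on which \<open>Z\<close> does not vanish.\<close>
        define c where "c = w k / u k"
        let ?d = "\<lambda>i. 1 * w i + (- c) * u i"
        have "bil_form r Y ?d ?d = 0"
          using Yw u(2) bil_form_kernel[OF Yp Yw] by (subst bil_form_comb[OF Yp]) simp
        moreover have "\<forall>i<r. k \<le> i \<longrightarrow> ?d i = 0"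
          using w(1) u(1) \<open>u k \<noteq> 0\<close> by (auto simp: c_def le_eq_less_or_eq Suc_le_eq)
        ultimately have "\<forall>i<r. ?d i = 0" using Y(2)[of ?d] by blast
        then have wu: "w i = c * u i" if "i < r" for i using that by auto
        then have "bil_form r Z w w = bil_form r Z (\<lambda>i. c * u i + 0 * u i) (\<lambda>i. c * u i + 0 * u i)"
          by (intro bil_form_cong) auto
        then have "c\<^sup>2 * bil_form r Z u u = 0"
          using Zw by (subst (asm) bil_form_comb[OF Zp]) simp
        then have "c = 0" using Z by simp
        then show ?thesis using wu by simp
      qed
      then show False using no avg[OF Y(1) Z(1)] by blast
    qed
  qed
  from this[of r] show ?thesis unfolding pos_def_def by auto
qed

text \<open>Every form is congruent to one in which the common kernel of the matrices that are feasible
  over \<open>X\<close> is spanned by the last unit vectors.\<close>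

lemma adapted_form:
  fixes S :: "('a::euclidean_space \<times> real mat \<times> real) set"
  assumes S: "sdp_form S r K"
  obtains P Q t where "P \<in> carrier_mat r r" "Q \<in> carrier_mat r r" "P * Q = 1\<^sub>m r" "Q * P = 1\<^sub>m r"
    "sdp_form (transform_form Q S) r K" "t \<le> r"
    "\<forall>x \<in> X. \<forall>Y i. feasible (transform_form Q S) r x Y \<longrightarrow> t \<le> i \<longrightarrow> i < r \<longrightarrow> Y $$ (i, i) = 0"
    "\<forall>c. (\<forall>i. t \<le> i \<longrightarrow> i < r \<longrightarrow> c i = 0) \<longrightarrow>
       (\<forall>x \<in> X. \<forall>Y. feasible (transform_form Q S) r x Y \<longrightarrow> bil_form r Y c c = 0) \<longrightarrow>
       (\<forall>i<r. c i = 0)"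
proof -
  have psd: "\<forall>(a, U, b) \<in> S. U \<in> psd_matrices r" using S by (simp add: sdp_form_def)
  \<comment> \<open>For psd matrices isotropic vectors are kernel vectors, so \<open>N\<close> is
    the common kernel.\<close>
  define N where "N = {u. \<forall>x \<in> X. \<forall>Y. feasible S r x Y \<longrightarrow> bil_form r Y (($) u) (($) u) = 0}"
  obtain P Q t where P: "P \<in> carrier_mat r r" and Q: "Q \<in> carrier_mat r r"
    and PQ: "P * Q = 1\<^sub>m r" and QP: "Q * P = 1\<^sub>m r" and t: "t \<le> r"
    and cols: "\<And>i. t \<le> i \<Longrightarrow> i < r \<Longrightarrow> col P i \<in> N"
    and triv: "\<And>c. c \<in> carrier_vec r \<Longrightarrow> (\<And>i. t \<le> i \<Longrightarrow> i < r \<Longrightarrow> c $ i = 0) \<Longrightarrow>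
       P *\<^sub>v c \<in> N \<Longrightarrow> c = 0\<^sub>v r"
    by (rule adapted_basis[of r N]) (rule that; blast)
  let ?S = "transform_form Q S"
  have pull: "feasible S r x (congruence Q Y)" "congruence P (congruence Q Y) = Y"
    if "feasible ?S r x Y" for x Y
    using feasible_transform_form[OF psd Q feasibleD(1)[OF that]] that
      congruence_inverse[OF Q P psd_carrier[OF feasibleD(1)[OF that]] QP] by auto
  have push: "feasible ?S r x (congruence P Y)" if "feasible S r x Y" for x Y
  proof -
    have Y: "Y \<in> psd_matrices r" using that by (rule feasibleD)
    have "congruence Q (congruence P Y) = Y"
      using congruence_inverse[OF P Q psd_carrier[OF Y] PQ] .
    then show ?thesis
      using feasible_transform_form[OF psd Q congruence_psd[OF P Y]] that by simp
  qed
  show thesis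
  proof (rule that[OF P Q PQ QP sdp_form_transform_form[OF S P Q PQ] t], goal_cases)
    case 1
    show ?case
    proof (intro ballI allI impI)
      fix x Y i assume x: "x \<in> X" "feasible ?S r x Y" and i: "t \<le> i" "i < r"
      note Y = psd_carrier[OF feasibleD(1)[OF x(2)]]
      \<comment> \<open>In the new coordinates a diagonal entry is the old form evaluated at a
        column of \<open>P\<close>, and this column lies in \<open>N\<close>.\<close>
      have "Y $$ (i, i) = congruence P (congruence Q Y) $$ (i, i)" using pull(2)[OF x(2)] by simp
      also have "\<dots> = bil_form r (congruence Q Y) (\<lambda>k. P $$ (k, i)) (\<lambda>k. P $$ (k, i))"
        using P Q Y i by (intro congruence_index) auto
      also have "\<dots> = bil_form r (congruence Q Y) (($) (col P i)) (($) (col P i))"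
        using P i by (intro bil_form_cong) auto
      also have "\<dots> = 0" using cols[OF i] x pull(1) by (simp add: N_def)
      finally show "Y $$ (i, i) = 0" .
    qed
  next
    case 2
    have "\<forall>i<r. c i = 0" if c0: "\<forall>i. t \<le> i \<longrightarrow> i < r \<longrightarrow> c i = 0"
      and ker: "\<forall>x \<in> X. \<forall>Y. feasible ?S r x Y \<longrightarrow> bil_form r Y c c = 0" for c
    proof -
      have "bil_form r Y (($) (P *\<^sub>v vec r c)) (($) (P *\<^sub>v vec r c)) = 0"
        if "x \<in> X" "feasible S r x Y" for x Y
      proof -
        have "bil_form r Y (($) (P *\<^sub>v vec r c)) (($) (P *\<^sub>v vec r c)) =
            bil_form r Y (mat_app r P c) (mat_app r P c)"
          using P by (intro bil_form_cong) (auto simp: mat_app_def scalar_prod_def atLeast0LessThan)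
        also have "\<dots> = bil_form r (congruence P Y) c c"
          using P psd_carrier[OF feasibleD(1)[OF that(2)]] by (simp add: bil_form_congruence)
        also have "\<dots> = 0" using ker that push by blast
        finally show ?thesis .
      qed
      then have "P *\<^sub>v vec r c \<in> N" by (auto simp: N_def)
      then have "vec r c = 0\<^sub>v r" using c0 by (intro triv) auto
      then show "\<forall>i<r. c i = 0" by (metis index_vec index_zero_vec(1))
    qed
    then show ?case by blast
  qed
qed

text \<open>Otherwise the facial reduction of \<open>has_sdp_formulation_restrict\<close> would yield a smaller form.\<close>

lemma minimal_form_pos_def:
  assumes S: "sdp_form S r K" and min: "\<And>n. has_sdp_formulation K n \<Longrightarrow> r \<le> n" and "K \<noteq> {}"
  shows "\<exists>x Y. feasible S r x Y \<and> pos_def r Y"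
proof -
  have psd: "\<forall>(a, U, b) \<in> S. U \<in> psd_matrices r" using S by (simp add: sdp_form_def)
  obtain P Q t where P: "P \<in> carrier_mat r r" and Q: "Q \<in> carrier_mat r r" and PQ: "P * Q = 1\<^sub>m r"
    and QP: "Q * P = 1\<^sub>m r" and S': "sdp_form (transform_form Q S) r K" and t: "t \<le> r"
    and zero: "\<forall>x \<in> UNIV. \<forall>Y i. feasible (transform_form Q S) r x Y \<longrightarrow> t \<le> i \<longrightarrow> i < r \<longrightarrow> Y $$ (i, i) = 0"
    and triv: "\<forall>c. (\<forall>i. t \<le> i \<longrightarrow> i < r \<longrightarrow> c i = 0) \<longrightarrow>
       (\<forall>x \<in> UNIV. \<forall>Y. feasible (transform_form Q S) r x Y \<longrightarrow> bil_form r Y c c = 0) \<longrightarrow>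
       (\<forall>i<r. c i = 0)"
    by (rule adapted_form[OF S, of UNIV])
  let ?S = "transform_form Q S"
  have "has_sdp_formulation K t"
    using zero by (intro has_sdp_formulation_restrict[OF S' t]) blast
  then have [simp]: "t = r" using min t by (meson le_antisym)
  define F where "F = {Y. \<exists>x. feasible ?S r x Y}"
  have psd': "\<forall>(a, U, b) \<in> ?S. U \<in> psd_matrices r" using S' by (simp add: sdp_form_def)
  have "\<exists>Y \<in> F. pos_def r Y"
  proof (rule pos_def_of_family)
    show "F \<subseteq> psd_matrices r" using feasibleD(1) by (auto simp: F_def)
    show "F \<noteq> {}" using \<open>K \<noteq> {}\<close> sdp_formD(3)[OF S'] by (auto simp: F_def)
    show "mat_comb r (1/2) Y (1/2) Z \<in> F" if YZ: "Y \<in> F" "Z \<in> F" for Y Z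
    proof -
      obtain x y where "feasible ?S r x Y" "feasible ?S r y Z" using YZ by (auto simp: F_def)
      then have "feasible ?S r ((1/2) *\<^sub>R x + (1/2) *\<^sub>R y) (mat_comb r (1/2) Y (1/2) Z)"
        by (intro feasible_convex[OF psd']) auto
      then show ?thesis by (auto simp: F_def)
    qed
    show "\<forall>i<r. u i = 0" if "\<forall>Y \<in> F. bil_form r Y u u = 0" for u
    proof -
      have "\<forall>x \<in> UNIV. \<forall>Y. feasible ?S r x Y \<longrightarrow> bil_form r Y u u = 0"
        using that by (auto simp: F_def)
      then show ?thesis using triv by simp
    qed
  qed
  then obtain x Y where Y: "feasible ?S r x Y" "pos_def r Y" by (auto simp: F_def)
  have Yp: "Y \<in> psd_matrices r" using Y(1) by (rule feasibleD)
  have "feasible S r x (congruence Q Y)"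
    using feasible_transform_form[OF psd Q Yp] Y(1) by simp
  moreover have "pos_def r (congruence Q Y)"
    unfolding pos_def_def
  proof (intro allI impI)
    fix u i assume u: "bil_form r (congruence Q Y) u u = 0" and i: "i < r"
    have "\<forall>i<r. mat_app r Q u i = 0"
      using u Y(2) bil_form_congruence[OF Q psd_carrier[OF Yp]] by (simp add: pos_def_def)
    moreover have "Q *\<^sub>v vec r u = vec r (mat_app r Q u)"
      using Q by (intro eq_vecI) (auto simp: mat_app_def scalar_prod_def atLeast0LessThan)
    ultimately have "Q *\<^sub>v vec r u = 0\<^sub>v r"
      by (intro eq_vecI) auto
    moreover have "vec r u = P *\<^sub>v (Q *\<^sub>v vec r u)"
      using assoc_mult_mat_vec[OF P Q, of "vec r u"] PQ by simp
    ultimately have "vec r u = P *\<^sub>v 0\<^sub>v r" by simp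
    also have "\<dots> = 0\<^sub>v r" using P by (intro eq_vecI) auto
    finally show "u i = 0" using i by (metis index_vec index_zero_vec(1))
  qed
  ultimately show ?thesis by blast
qed

text \<open>Let \<open>w\<close> be row \<open>i\<close> of the inverse of \<open>Y\<close>. The
  form pairs \<open>w\<close> with \<open>v\<close> to \<open>v i\<close>, and the Cauchy-Schwarz
  inequality gives the constant \<open>bil_form r Y w w\<close>. The bound makes a positive definite
  matrix an order unit.\<close>

lemma pos_def_coordinate_bound:
  assumes Y: "Y \<in> psd_matrices r" and pd: "pos_def r Y" and i: "i < r"
  shows "\<exists>C \<ge> 0. \<forall>v. (v i)\<^sup>2 \<le> C * bil_form r Y v v"
proof -
  have cY: "Y \<in> carrier_mat r r" using Y by (rule psd_carrier)
  have "det Y \<noteq> 0"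
  proof
    assume "det Y = 0"
    then obtain d where d: "d \<in> carrier_vec r" "d \<noteq> 0\<^sub>v r" "Y *\<^sub>v d = 0\<^sub>v r"
      using det_0_iff_vec_prod_zero_field[OF cY] by blast
    have "bil_form r Y (($) d) (($) d) = (\<Sum>i<r. d $ i * (Y *\<^sub>v d) $ i)"
      using cY d(1) by (auto simp: bil_form_def scalar_prod_def sum_distrib_left atLeast0LessThan
          algebra_simps intro!: sum.cong)
    also have "\<dots> = 0" using d(3) by simp
    finally have "\<forall>i<r. d $ i = 0" using pd by (simp add: pos_def_def)
    then show False using d by (metis carrier_vecD eq_vecI index_zero_vec)
  qed
  from det_non_zero_imp_unit[OF cY this, of "()"]
  obtain B where B: "B \<in> carrier_mat r r" "B * Y = 1\<^sub>m r"
    unfolding Units_def ring_mat_def by auto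
  define w where "w = (\<lambda>k. B $$ (i, k))"
  have "bil_form r Y w v = v i" for v
  proof -
    have "(\<Sum>k<r. w k * Y $$ (k, l)) = (B * Y) $$ (i, l)" if "l < r" for l
      using B(1) cY that i by (simp add: w_def scalar_prod_def atLeast0LessThan)
    then have row: "(\<Sum>k<r. w k * Y $$ (k, l)) = (if i = l then 1 else 0)" if "l < r" for l
      using B(2) that i by simp
    have "bil_form r Y w v = (\<Sum>l<r. (\<Sum>k<r. w k * Y $$ (k, l)) * v l)"
      unfolding bil_form_def by (subst sum.swap) (simp add: sum_distrib_right sum_distrib_left mult_ac)
    also have "\<dots> = (\<Sum>l<r. if i = l then v l else 0)"
      by (intro sum.cong refl) (simp add: row)
    also have "\<dots> = v i" using i by simp
    finally show ?thesis .
  qed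
  then show ?thesis
    using bil_form_Cauchy_Schwarz[OF Y, of w] psd_nonneg[OF Y, of w]
    by (intro exI[of _ "bil_form r Y w w"]) auto
qed

subsection \<open>Conic duality\<close>

lemma sum_of_bool_eq:
  "finite I \<Longrightarrow> a \<in> I \<Longrightarrow> (\<Sum>i\<in>I. w i * of_bool (i = a)) = (w a :: real)"
  by (simp add: of_bool_def if_distrib[of "\<lambda>x. _ * x"] cong: if_cong)

text \<open>The quadratic form of the matrix part of an encoded pair; that part may be asymmetric,
  and the form sees only its symmetric part.\<close>

definition fun_form :: "nat \<Rightarrow> ((nat \<times> nat) option \<Rightarrow> real) \<Rightarrow> (nat \<Rightarrow> real) \<Rightarrow> real" where
  "fun_form r p v = (\<Sum>i<r. \<Sum>j<r. p (Some (i, j)) * v i * v j)"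

lemma fun_form_linear:
  "fun_form r (\<lambda>e. a * p e + b * q e) v = a * fun_form r p v + b * fun_form r q v"
  by (simp add: fun_form_def sum_distrib_left sum.distrib algebra_simps)

lemma fun_form_unit:
  assumes "k < r" "l < r"
  shows "fun_form r (\<lambda>i. of_bool (i = Some (k, l))) v = v k * v l"
proof -
  have "of_bool (Some (i, j) = Some (k, l)) * v i * v j =
      (if i = k then v i else 0) * (if j = l then v j else 0)" for i j
    by simp
  then have "fun_form r (\<lambda>i. of_bool (i = Some (k, l))) v =
      (\<Sum>i<r. if i = k then v i else 0) * (\<Sum>j<r. if j = l then v j else 0)"
    unfolding fun_form_def sum_product by simp
  then show ?thesis
    using assms by simp
qed

lemma fun_form_unit_None [simp]: "fun_form r (\<lambda>i. of_bool (i = None)) v = 0"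
  by (simp add: fun_form_def)

text \<open>A positive functional on the space of pairs \<open>(\<tau>, Y)\<close> satisfying the homogenized equations,
  extended to all pairs. Pairs are encoded as functions on an option type: \<open>None\<close> holds \<open>\<tau>\<close>
  and \<open>Some (i, j)\<close> holds the entry of \<open>Y\<close> at \<open>(i, j)\<close>.\<close>

lemma sdp_duality:
  fixes S :: "('a::euclidean_space \<times> real mat \<times> real) set"
  assumes S: "sdp_form S r K" and feas0: "feasible S r x0 Y0" and pd: "pos_def r Y0"
    and valid: "\<And>x. x \<in> K \<Longrightarrow> inner g x \<le> \<beta>"
  shows "\<exists>W c. W \<in> psd_matrices r \<and> c \<ge> 0 \<and>
    (\<forall>x Y. feasible S r x Y \<longrightarrow> \<beta> - inner g x = frobenius_inner W Y + c)"
proof -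
  have psd: "\<forall>(a, U, b) \<in> S. U \<in> psd_matrices r" using S by (simp add: sdp_form_def)
  have Y0: "Y0 \<in> psd_matrices r" using feas0 by (rule feasibleD)
  define I where "I = insert None (Some ` ({..<r} \<times> {..<r}))"
  \<comment> \<open>Symmetry is not imposed: antisymmetric matrices lie in \<open>C\<close> with
    both signs, which later forces the dual matrix \<open>W\<close> to be symmetric.\<close>
  define C where "C = {p. p None \<ge> 0 \<and> (\<forall>v. fun_form r p v \<ge> 0)}"
  define L :: "real mat \<Rightarrow> ((nat \<times> nat) option \<Rightarrow> real) \<Rightarrow> real"
    where "L = (\<lambda>U p. \<Sum>i<r. \<Sum>j<r. U $$ (i, j) * p (Some (i, j)))"
  \<comment> \<open>The functional is the homogenized slack of the inequality. That it does not
    depend on the choice of \<open>x\<close> is a consequence of positivity.\<close>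
  define M where "M = {(p, h). \<exists>x. (\<forall>(a, U, b) \<in> S. inner a x + L U p = b * p None) \<and>
    h = \<beta> * p None - inner g x}"
  have fin: "finite I" by (simp add: I_def)
  have L_lin: "L U (\<lambda>e. a * p e + b * q e) = a * L U p + b * L U q" for U a p b q
    by (simp add: L_def sum_distrib_left sum.distrib algebra_simps)
  have M: "lin_graph M"
    unfolding lin_graph_def
  proof (intro allI impI)
    fix p h q k a b assume "(p, h) \<in> M" "(q, k) \<in> M"
    then obtain x y where x: "\<forall>(a, U, b) \<in> S. inner a x + L U p = b * p None" "h = \<beta> * p None - inner g x"
      and y: "\<forall>(a, U, b) \<in> S. inner a y + L U q = b * q None" "k = \<beta> * q None - inner g y"
      unfolding M_def by auto
    have eq: "inner a' (a *\<^sub>R x + b *\<^sub>R y) + L U (\<lambda>e. a * p e + b * q e) = b' * (a * p None + b * q None)"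
      if "(a', U, b') \<in> S" for a' U b'
    proof -
      have 1: "inner a' x + L U p = b' * p None" and 2: "inner a' y + L U q = b' * q None"
        using x(1) y(1) that by auto
      have "inner a' (a *\<^sub>R x + b *\<^sub>R y) + L U (\<lambda>e. a * p e + b * q e) =
          a * (inner a' x + L U p) + b * (inner a' y + L U q)"
        by (simp add: L_lin inner_add_right algebra_simps)
      then show ?thesis unfolding 1 2 by (simp add: algebra_simps)
    qed
    have "a * h + b * k = \<beta> * (a * p None + b * q None) - inner g (a *\<^sub>R x + b *\<^sub>R y)"
      unfolding x(2) y(2) by (simp add: inner_add_right algebra_simps)
    with eq show "((\<lambda>e. a * p e + b * q e), a * h + b * k) \<in> M"
      unfolding M_def mem_Collect_eq prod.case by (intro exI[of _ "a *\<^sub>R x + b *\<^sub>R y"]) blast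
  qed
  have add: "(\<lambda>e. p e + q e) \<in> C" if "p \<in> C" "q \<in> C" for p q
    using that fun_form_linear[of r 1 p 1 q] by (simp add: C_def)
  have scale: "(\<lambda>e. a * p e) \<in> C" if "a > 0" "p \<in> C" for a p
    using that fun_form_linear[of r a p 0 p] by (simp add: C_def)
  have zero: "(\<lambda>e. 0) \<in> C" by (simp add: C_def fun_form_def)
  have pos: "h \<ge> 0" if ph: "(p, h) \<in> M" and pC: "p \<in> C" for p h
  proof -
    obtain x where x: "\<forall>(a, U, b) \<in> S. inner a x + L U p = b * p None" "h = \<beta> * p None - inner g x"
      using ph unfolding M_def by auto
    have p: "p None \<ge> 0" "\<And>v. fun_form r p v \<ge> 0" using pC by (auto simp: C_def)
    \<comment> \<open>Symmetrization changes neither the form nor the inner products with the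
      symmetric coefficients.\<close>
    define Y where "Y = mat r r (\<lambda>(i, j). (p (Some (i, j)) + p (Some (j, i))) / 2)"
    have "bil_form r Y v v = fun_form r p v" for v
    proof -
      have "bil_form r Y v v = (fun_form r p v + (\<Sum>i<r. \<Sum>j<r. p (Some (j, i)) * v i * v j)) / 2"
        by (simp add: bil_form_def fun_form_def Y_def sum_divide_distrib sum.distrib algebra_simps
            add_divide_distrib)
      also have "(\<Sum>i<r. \<Sum>j<r. p (Some (j, i)) * v i * v j) = fun_form r p v"
        unfolding fun_form_def by (subst sum.swap) (simp add: algebra_simps)
      finally show ?thesis by simp
    qed
    then have Y: "Y \<in> psd_matrices r"
      using p(2) by (intro psdI) (auto simp: Y_def)
    have LY: "frobenius_inner U Y = L U p" if "(a, U, b) \<in> S" for a U b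
    proof -
      have U: "U \<in> psd_matrices r" using psd that by blast
      have "frobenius_inner U Y = (L U p + (\<Sum>i<r. \<Sum>j<r. U $$ (i, j) * p (Some (j, i)))) / 2"
        using psd_carrier[OF U]
        by (simp add: frobenius_inner_carrier[of _ r] L_def Y_def sum_divide_distrib sum.distrib
            algebra_simps add_divide_distrib)
      also have "(\<Sum>i<r. \<Sum>j<r. U $$ (i, j) * p (Some (j, i))) = L U p"
        unfolding L_def by (subst sum.swap) (use psd_sym[OF U] in simp)
      finally show ?thesis by simp
    qed
    \<comment> \<open>Since \<open>p None\<close> may be zero, the pair cannot be normalized
      directly; adding \<open>\<epsilon>\<close> times the feasible point \<open>(x0, Y0)\<close>
      makes the homogenizing variable positive.\<close>
    have ineq: "h + \<epsilon> * (\<beta> - inner g x0) \<ge> 0" if "\<epsilon> > 0" for \<epsilon>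
    proof -
      define \<tau> where "\<tau> = p None + \<epsilon>"
      have \<tau>: "\<tau> > 0" using p(1) that by (simp add: \<tau>_def)
      define z where "z = (1/\<tau>) *\<^sub>R (x + \<epsilon> *\<^sub>R x0)"
      let ?Z = "mat_comb r (1/\<tau>) Y (\<epsilon>/\<tau>) Y0"
      have "feasible S r z ?Z"
        unfolding feasible_def
      proof (intro conjI ballI)
        show "?Z \<in> psd_matrices r" using Y Y0 \<tau> that by (intro mat_comb_psd) auto
      next
        fix s assume s: "s \<in> S"
        obtain a U b where [simp]: "s = (a, U, b)" by (cases s)
        have U: "U \<in> carrier_mat r r" using psd s psd_carrier by auto
        have 1: "inner a x + L U p = b * p None" using x(1) s by auto
        have 2: "inner a x0 + frobenius_inner U Y0 = b" using feasibleD(2)[OF feas0] s by auto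
        have "inner a z + frobenius_inner U ?Z =
            (1/\<tau>) * ((inner a x + L U p) + \<epsilon> * (inner a x0 + frobenius_inner U Y0))"
          using s LY by (simp add: frobenius_inner_mat_comb[OF U] z_def inner_add_right algebra_simps)
        also have "\<dots> = b" unfolding 1 2 using \<tau> by (simp add: \<tau>_def field_simps)
        finally show "case s of (a, U, b) \<Rightarrow> inner a z + frobenius_inner U ?Z = b" by simp
      qed
      then have "inner g z \<le> \<beta>" using sdp_formD(2)[OF S] valid by blast
      then have "inner g x + \<epsilon> * inner g x0 \<le> \<beta> * \<tau>"
        using \<tau> by (simp add: z_def inner_add_right field_simps)
      then show ?thesis using x(2) by (simp add: \<tau>_def algebra_simps)
    qed
    have k: "\<beta> - inner g x0 \<ge> 0" using sdp_formD(2)[OF S feas0] valid by simp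
    show "h \<ge> 0"
    proof (rule ccontr)
      assume "\<not> h \<ge> 0"
      then have h: "h < 0" by simp
      \<comment> \<open>With \<open>\<epsilon> = - (h / d)\<close> the bound reads
        \<open>h / d \<ge> 0\<close>; the summand 1 keeps \<open>d\<close> positive even if
        \<open>x0\<close> has slack zero.\<close>
      define d where "d = \<beta> - inner g x0 + 1"
      have d: "d > 0" using k by (simp add: d_def)
      have neg: "h / d < 0" using h d by (rule divide_neg_pos)
      have "h + (- (h / d)) * (\<beta> - inner g x0) \<ge> 0"
        by (rule ineq) (use neg in simp)
      also have "\<beta> - inner g x0 = d - 1" by (simp add: d_def)
      also have "h + (- (h / d)) * (d - 1) = h / d" using d by (simp add: field_simps)
      finally show False using neg by simp
    qed
  qed
  define p0 :: "(nat \<times> nat) option \<Rightarrow> real"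
    where "p0 = (\<lambda>e. case e of None \<Rightarrow> 1 | Some (i, j) \<Rightarrow> Y0 $$ (i, j))"
  have p0_None: "p0 None = 1" by (simp add: p0_def)
  have form0: "fun_form r p0 v = bil_form r Y0 v v" for v
    by (simp add: p0_def fun_form_def bil_form_def)
  have p0M: "((\<lambda>e. a * p0 e), a * (\<beta> - inner g x0)) \<in> M" for a
  proof -
    have eq: "inner a' (a *\<^sub>R x0) + L U (\<lambda>e. a * p0 e) = b * (a * p0 None)" if "(a', U, b) \<in> S" for a' U b
    proof -
      have "frobenius_inner U Y0 = L U p0"
        using psd that psd_carrier[of U r] by (auto simp: L_def p0_def frobenius_inner_carrier)
      then have 1: "inner a' x0 + L U p0 = b" using feasibleD(2)[OF feas0 that] by simp
      have "L U (\<lambda>e. a * p0 e) = a * L U p0" using L_lin[of U a p0 0 p0] by simp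
      then have "inner a' (a *\<^sub>R x0) + L U (\<lambda>e. a * p0 e) = a * (inner a' x0 + L U p0)"
        by (simp add: algebra_simps)
      then show ?thesis unfolding 1 by (simp add: p0_None)
    qed
    have "a * (\<beta> - inner g x0) = \<beta> * (a * p0 None) - inner g (a *\<^sub>R x0)"
      by (simp add: p0_None algebra_simps)
    with eq show ?thesis
      unfolding M_def mem_Collect_eq prod.case by (intro exI[of _ "a *\<^sub>R x0"]) blast
  qed
  \<comment> \<open>The positive definite \<open>Y0\<close> is used here: a multiple of
    \<open>p0\<close> dominates every unit vector with either sign, as the extension theorem
    requires.\<close>
  have order_unit: "\<exists>(u, h) \<in> M. (\<lambda>i. u i + s * of_bool (i = k)) \<in> C" if "k \<in> I" and s: "\<bar>s\<bar> = 1" for k s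
  proof (cases k)
    case None
    have "fun_form r (\<lambda>i. 1 * p0 i + s * of_bool (i = None)) v \<ge> 0" for v
      using form0 psd_nonneg[OF Y0] by (subst fun_form_linear) simp
    then have mem: "(\<lambda>i. 1 * p0 i + s * of_bool (i = k)) \<in> C"
      using s None by (auto simp: C_def p0_def)
    show ?thesis by (rule bexI[OF _ p0M[of 1]], unfold prod.case, fact mem)
  next
    case (Some a)
    then obtain i j where ij: "k = Some (i, j)" "i < r" "j < r" using \<open>k \<in> I\<close> by (auto simp: I_def)
    obtain c d where c: "c \<ge> 0" "\<And>v. (v i)\<^sup>2 \<le> c * bil_form r Y0 v v"
      and d: "d \<ge> 0" "\<And>v. (v j)\<^sup>2 \<le> d * bil_form r Y0 v v"
      using pos_def_coordinate_bound[OF Y0 pd] ij by metis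
    have "fun_form r (\<lambda>i. (c + d) * p0 i + s * of_bool (i = k)) v \<ge> 0" for v
    proof -
      have "\<bar>v i * v j\<bar> \<le> (v i)\<^sup>2 + (v j)\<^sup>2"
        using sum_squares_bound[of "v i" "v j"] sum_squares_bound[of "v i" "- v j"]
          sum_power2_ge_zero[of "v i" "v j"] by (auto simp: abs_if)
      also have "\<dots> \<le> (c + d) * bil_form r Y0 v v" using c(2)[of v] d(2)[of v] by (simp add: algebra_simps)
      finally have "\<bar>s * (v i * v j)\<bar> \<le> (c + d) * bil_form r Y0 v v" using s by (simp add: abs_mult)
      then show ?thesis
        unfolding fun_form_linear ij(1) using ij by (simp add: fun_form_unit form0)
    qed
    then have mem: "(\<lambda>i. (c + d) * p0 i + s * of_bool (i = k)) \<in> C"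
      using c d ij by (auto simp: C_def p0_def)
    show ?thesis by (rule bexI[OF _ p0M[of "c + d"]], unfold prod.case, fact mem)
  qed
  have up: "\<exists>(u, h) \<in> M. (\<lambda>i. u i + of_bool (i = k)) \<in> C" if "k \<in> I" for k
    using order_unit[OF that, of 1] by simp
  have down: "\<exists>(u, h) \<in> M. (\<lambda>i. u i - of_bool (i = k)) \<in> C" if "k \<in> I" for k
    using order_unit[OF that, of "-1"] by simp
  have "M \<noteq> {}" using p0M by blast
  have pos': "\<forall>(p, h) \<in> M. p \<in> C \<longrightarrow> h \<ge> 0" using pos by blast
  obtain w where w_eq: "\<And>p h. (p, h) \<in> M \<Longrightarrow> (\<And>i. i \<notin> I \<Longrightarrow> p i = 0) \<Longrightarrow> h = (\<Sum>i\<in>I. w i * p i)"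
    and w_pos: "\<And>p. p \<in> C \<Longrightarrow> (\<And>i. i \<notin> I \<Longrightarrow> p i = 0) \<Longrightarrow> (\<Sum>i\<in>I. w i * p i) \<ge> 0"
    by (rule positive_functional[OF fin M add scale zero pos' up down \<open>M \<noteq> {}\<close>]) (assumption | blast)+
  have sum_I: "(\<Sum>e\<in>I. f e) = f None + (\<Sum>i<r. \<Sum>j<r. f (Some (i, j)))" for f :: "_ \<Rightarrow> real"
  proof -
    have "(\<Sum>e\<in>I. f e) = f None + (\<Sum>e\<in>Some ` ({..<r} \<times> {..<r}). f e)"
      unfolding I_def by (rule sum.insert) auto
    also have "(\<Sum>e\<in>Some ` ({..<r} \<times> {..<r}). f e) = (\<Sum>i<r. \<Sum>j<r. f (Some (i, j)))"
      by (subst sum.reindex) (auto simp: sum.cartesian_product')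
    finally show ?thesis .
  qed
  define W where "W = mat r r (\<lambda>(i, j). w (Some (i, j)))"
  have c: "w None \<ge> 0"
  proof -
    have "(\<lambda>i. of_bool (i = None)) \<in> C" by (simp add: C_def)
    then have "(\<Sum>i\<in>I. w i * of_bool (i = None)) \<ge> 0" by (rule w_pos) (auto simp: I_def)
    also have "(\<Sum>i\<in>I. w i * of_bool (i = None)) = w None"
      by (rule sum_of_bool_eq[OF fin]) (simp add: I_def)
    finally show ?thesis .
  qed
  have W: "W \<in> psd_matrices r"
  proof (rule psdI)
    fix i j assume ij: "i < r" "j < r"
    have le: "w (Some (i, j)) \<ge> w (Some (j, i))" if ij: "i < r" "j < r" for i j
    proof -
      let ?p = "\<lambda>e. 1 * of_bool (e = Some (i, j)) + (-1) * of_bool (e = Some (j, i))"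
      have "fun_form r ?p v = 0" for v
        using ij by (subst fun_form_linear) (simp add: fun_form_unit)
      then have "?p \<in> C" by (simp add: C_def)
      then have "(\<Sum>e\<in>I. w e * ?p e) \<ge> 0" by (rule w_pos) (use ij in \<open>auto simp: I_def\<close>)
      also have "(\<Sum>e\<in>I. w e * ?p e) =
          (\<Sum>e\<in>I. w e * of_bool (e = Some (i, j))) - (\<Sum>e\<in>I. w e * of_bool (e = Some (j, i)))"
        by (simp add: algebra_simps sum_subtractf)
      also have "\<dots> = w (Some (i, j)) - w (Some (j, i))"
        using ij by (subst (1 2) sum_of_bool_eq[OF fin]) (auto simp: I_def)
      finally show ?thesis by simp
    qed
    show "W $$ (i, j) = W $$ (j, i)"
      using le[OF ij] le[OF ij(2,1)] ij by (simp add: W_def)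
  next
    fix v :: "nat \<Rightarrow> real"
    \<comment> \<open>The rank one matrix with entries \<open>v i * v j\<close>, at which the
      functional takes the value \<open>bil_form r W v v\<close>.\<close>
    let ?p = "\<lambda>e. case e of None \<Rightarrow> 0 | Some (i, j) \<Rightarrow> if i < r \<and> j < r then v i * v j else (0::real)"
    have "fun_form r ?p u = (\<Sum>i<r. v i * u i)\<^sup>2" for u
      by (simp add: fun_form_def power2_eq_square sum_product mult_ac)
    then have "?p \<in> C" by (simp add: C_def)
    then have "(\<Sum>e\<in>I. w e * ?p e) \<ge> 0"
      by (rule w_pos) (auto simp: I_def split: option.splits)
    then show "bil_form r W v v \<ge> 0"
      by (simp add: sum_I bil_form_def W_def mult_ac)
  qed (simp add: W_def)
  have "\<beta> - inner g x = frobenius_inner W Y + w None" if xY: "feasible S r x Y" for x Y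
  proof -
    let ?p = "\<lambda>e. case e of None \<Rightarrow> (1::real) | Some (i, j) \<Rightarrow> if i < r \<and> j < r then Y $$ (i, j) else 0"
    have "L U ?p = frobenius_inner U Y" if "(a, U, b) \<in> S" for a U b
      using psd that psd_carrier[of U r] by (auto simp: L_def frobenius_inner_carrier)
    then have "\<forall>(a, U, b) \<in> S. inner a x + L U ?p = b * ?p None"
      using feasibleD(2)[OF xY] by auto
    then have "(?p, \<beta> * ?p None - inner g x) \<in> M"
      unfolding M_def by blast
    then have "\<beta> * ?p None - inner g x = (\<Sum>e\<in>I. w e * ?p e)"
      by (rule w_eq) (auto simp: I_def split: option.splits)
    then show ?thesis
      by (simp add: sum_I frobenius_inner_def W_def)
  qed
  then show ?thesis using W c by blast
qed

text \<open>Induction on the number \<open>m\<close> of possibly nonzero rows of \<open>W\<close>; the step splits off a rank one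
  matrix, and the remainder (the Schur complement) is psd by the Cauchy-Schwarz inequality.\<close>

lemma psd_frobenius_inner_nonneg:
  assumes "W \<in> psd_matrices r" and Z: "Z \<in> psd_matrices r"
  shows "frobenius_inner W Z \<ge> 0"
proof -
  have "frobenius_inner W Z \<ge> 0"
    if "m \<le> r" "W \<in> psd_matrices r" "\<And>i. i < r - m \<Longrightarrow> W $$ (i, i) = 0" for m W
    using that
  proof (induction m arbitrary: W)
    case 0
    then have "W $$ (i, j) = 0" if "i < r" "j < r" for i j
      using psd_diag_zero[OF 0(2) that] that by simp
    then show ?case
      using psd_carrier[OF 0(2)] by (simp add: frobenius_inner_carrier)
  next
    case (Suc m)
    define i where "i = r - Suc m"
    have i: "i < r" "r - m = Suc i" using Suc.prems(1) by (auto simp: i_def)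
    have W: "W \<in> psd_matrices r" and W0: "W $$ (j, j) = 0" if "j < i" for j
      using Suc.prems that by (auto simp: i_def)
    have W: "W \<in> psd_matrices r" by (rule Suc.prems)
    show ?case
    proof (cases "W $$ (i, i) = 0")
      case True
      then have "\<And>j. j < r - m \<Longrightarrow> W $$ (j, j) = 0"
        using W0 i by (metis less_Suc_eq)
      then show ?thesis using Suc.IH Suc.prems by simp
    next
      case False
      let ?e = "\<lambda>k. if k = i then 1 else 0 :: real"
      let ?w = "\<lambda>k. W $$ (i, k)"
      define d where "d = W $$ (i, i)"
      have "d = bil_form r W ?e ?e" using i by (simp add: d_def bil_form_unit)
      then have "d \<ge> 0" using psd_nonneg[OF W] by simp
      then have d: "d > 0" using False by (simp add: d_def)
      define R where "R = mat r r (\<lambda>(k, l). ?w k * ?w l)"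
      have row: "bil_form r W ?e v = (\<Sum>k<r. ?w k * v k)" for v
      proof -
        have "bil_form r W ?e v = (\<Sum>k<r. if k = i then \<Sum>j<r. W $$ (k, j) * v j else 0)"
          unfolding bil_form_def by (intro sum.cong refl) simp
        then show ?thesis using i by simp
      qed
      have R: "bil_form r R v v = (bil_form r W ?e v)\<^sup>2" for v
        unfolding row by (simp add: bil_form_def R_def power2_eq_square sum_product mult_ac)
      define X where "X = mat_comb r 1 W (- 1 / d) R"
      have "X \<in> psd_matrices r"
      proof (rule psdI)
        show "X $$ (k, l) = X $$ (l, k)" if "k < r" "l < r" for k l
          using psd_sym[OF W that] that by (simp add: X_def mat_comb_def R_def)
        fix v
        have "(bil_form r W ?e v)\<^sup>2 \<le> d * bil_form r W v v"
          using bil_form_Cauchy_Schwarz[OF W, of ?e v] \<open>d = bil_form r W ?e ?e\<close> by simp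
        then show "bil_form r X v v \<ge> 0"
          using d by (simp add: X_def bil_form_mat_comb R field_simps)
      qed (simp add: X_def mat_comb_def)
      moreover have "X $$ (j, j) = 0" if "j < r - m" for j
      proof (cases "j = i")
        case True
        then show ?thesis using i d by (simp add: X_def mat_comb_def R_def d_def)
      next
        case False
        then have "j < i" using that i by simp
        then have "W $$ (j, j) = 0" "W $$ (i, j) = 0"
          using W0 psd_diag_zero(2)[OF W, of j i] i by auto
        then show ?thesis using \<open>j < i\<close> i by (simp add: X_def mat_comb_def R_def)
      qed
      ultimately have "frobenius_inner X Z \<ge> 0"
        using Suc.IH Suc.prems(1) by simp
      moreover have "frobenius_inner W Z = frobenius_inner X Z + (1 / d) * bil_form r Z ?w ?w"
      proof -
        have "frobenius_inner X Z = frobenius_inner W Z - (1 / d) * (\<Sum>k<r. \<Sum>l<r. ?w k * ?w l * Z $$ (k, l))"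
          using psd_carrier[OF W]
          by (simp add: frobenius_inner_carrier[of _ r] X_def mat_comb_def R_def
              sum_distrib_left sum_subtractf algebra_simps)
        also have "(\<Sum>k<r. \<Sum>l<r. ?w k * ?w l * Z $$ (k, l)) = bil_form r Z ?w ?w"
          by (simp add: bil_form_def mult_ac)
        finally show ?thesis by simp
      qed
      ultimately show ?thesis using psd_nonneg[OF Z] d by simp
    qed
  qed
  from this[of r W] show ?thesis using assms by simp
qed

section \<open>Geometry of pyramids\<close>

text \<open>The component \<open>z\<close> of \<open>v - a\<close> orthogonal to the directions of
  the affine hull is nonzero; scaled by \<open>- 1 / inner z z\<close> it measures height with the
  apex at 0 and the base at 1.\<close>

lemma pyramid_height_functional:
  fixes v :: "'a::euclidean_space"
  assumes "v \<notin> affine hull B"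
  shows "\<exists>e. \<forall>b \<in> B. inner e (b - v) = 1"
proof (cases "B = {}")
  case False
  then obtain a where a: "a \<in> B" by blast
  let ?S = "(\<lambda>x. - a + x) ` B"
  obtain y z where y: "y \<in> span ?S" and z: "\<And>w. w \<in> span ?S \<Longrightarrow> inner z w = 0" and yz: "v - a = y + z"
    using orthogonal_subspace_decomp_exists[of ?S "v - a"]
    by (metis real_inner_class.orthogonal_def)
  have "z \<noteq> 0"
  proof
    assume "z = 0"
    then have "v = a + y" using yz by (simp add: algebra_simps)
    then have "v \<in> affine hull B"
      using y a affine_hull_span_gen[OF hull_inc[OF a]] by blast
    then show False using assms by simp
  qed
  have "inner (- (1 / inner z z) *\<^sub>R z) (b - v) = 1" if "b \<in> B" for b
  proof -
    have "inner z (- a + b) = 0" using z that by (auto intro: span_base)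
    moreover have "inner z y = 0" using z y by simp
    moreover have "b - v = (- a + b) - (y + z)" using yz by (simp add: algebra_simps)
    ultimately have "inner z (b - v) = - inner z z"
      by (simp only: inner_diff_right[of z "- a + b"] inner_add_right[of z y])
    then show ?thesis using \<open>z \<noteq> 0\<close> by simp
  qed
  then show ?thesis by blast
qed simp

text \<open>The inequalities tight at \<open>v\<close> describe the cone with apex \<open>v\<close>
  over the base, and the pyramid is this cone truncated at height 1. A point of positive height is
  pushed along its ray to height 1 and placed in \<open>Q\<close> by separation.\<close>

lemma pyramid_apex_cut:
  fixes Q :: "'a::euclidean_space set"
  assumes pyr: "pyramid_with Q B v" and e: "\<And>b. b \<in> B \<Longrightarrow> inner e (b - v) = 1"
    and tight: "\<And>g. (\<And>z. z \<in> Q \<Longrightarrow> inner g z \<le> inner g v) \<Longrightarrow> inner g x \<le> inner g v"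
    and base: "inner e (x - v) \<le> 1"
  shows "x \<in> Q"
proof -
  have Q: "Q = convex hull (B \<union> {v})" and "compact Q" "convex Q"
    using pyr polytope_imp_compact polytope_imp_convex by (auto simp: pyramid_with_def)
  have vQ: "v \<in> Q" and BQ: "B \<subseteq> Q" unfolding Q by (auto intro: hull_inc)
  have cut: "inner g x \<le> inner g v" if "\<And>b. b \<in> B \<Longrightarrow> inner g (b - v) \<le> 0" for g
  proof (rule tight)
    have "Q \<subseteq> {z. inner g z \<le> inner g v}"
      unfolding Q using that by (intro hull_minimal convex_halfspace_le) (auto simp: inner_diff_right)
    then show "\<And>z. z \<in> Q \<Longrightarrow> inner g z \<le> inner g v" by blast
  qed
  define l where "l = inner e (x - v)"
  have "inner (- e) x \<le> inner (- e) v" by (rule cut) (simp add: e)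
  then have "l \<ge> 0" by (simp add: l_def inner_diff_right)
  show ?thesis
  proof (cases "l = 0")
    case True
    obtain M where M: "\<And>z. z \<in> Q \<Longrightarrow> norm z \<le> M"
      using compact_imp_bounded[OF \<open>compact Q\<close>] by (auto simp: bounded_iff)
    \<comment> \<open>Bounds \<open>inner (x - v) (b - v)\<close> on the base, so subtracting
      \<open>N\<close> times the height gives an inequality valid on \<open>Q\<close> and tight at
      \<open>v\<close>; at height zero it says that \<open>x - v\<close> has norm zero.\<close>
    define N where "N = norm (x - v) * (M + norm v)"
    have "inner (x - v) (x - v) \<le> 0"
    proof -
      have "inner ((x - v) - N *\<^sub>R e) x \<le> inner ((x - v) - N *\<^sub>R e) v"
      proof (rule cut)
        fix b assume b: "b \<in> B"
        have "inner (x - v) (b - v) \<le> norm (x - v) * norm (b - v)" by (rule norm_cauchy_schwarz)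
        also have "\<dots> \<le> N"
          unfolding N_def using M[of b] b BQ norm_triangle_ineq4[of b v]
          by (intro mult_left_mono) auto
        finally show "inner ((x - v) - N *\<^sub>R e) (b - v) \<le> 0"
          using e[OF b] by (simp add: inner_diff_left)
      qed
      then have "inner ((x - v) - N *\<^sub>R e) (x - v) \<le> 0" by (simp add: inner_diff_right)
      then show ?thesis using True by (simp add: inner_diff_left l_def)
    qed
    then have "inner (x - v) (x - v) = 0" using inner_ge_zero[of "x - v"] by linarith
    then have "x = v" by simp
    then show ?thesis using vQ by simp
  next
    case False
    then have l: "l > 0" "l \<le> 1" using \<open>l \<ge> 0\<close> base by (auto simp: l_def)
    define y where "y = v + (1 / l) *\<^sub>R (x - v)"
    define H where "H = Q \<inter> {z. inner e z = 1 + inner e v}"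
    have "closed H" "convex H"
      unfolding H_def using \<open>compact Q\<close> \<open>convex Q\<close>
      by (auto intro!: closed_Int closed_hyperplane convex_Int convex_hyperplane compact_imp_closed)
    have "y \<in> H"
    proof (rule ccontr)
      assume "y \<notin> H"
      then obtain a c where a: "inner a y < c" "\<forall>z\<in>H. inner a z > c"
        using separating_hyperplane_closed_point \<open>closed H\<close> \<open>convex H\<close> by metis
      \<comment> \<open>Tilts the separating functional so that it becomes tight at
        \<open>v\<close>: on points \<open>z\<close> of height 1, \<open>k *\<^sub>R e - a\<close>
        applied to \<open>z - v\<close> equals \<open>c - inner a z\<close>.\<close>
      define k where "k = c - inner a v"
      have "inner (k *\<^sub>R e - a) x \<le> inner (k *\<^sub>R e - a) v"
      proof (rule cut)
        fix b assume b: "b \<in> B"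
        then have "b \<in> H" using BQ e[OF b] by (auto simp: H_def inner_diff_right)
        then have "inner a b > c" using a(2) by blast
        moreover have "inner (k *\<^sub>R e - a) (b - v) = k - inner a (b - v)"
          using e[OF b] by (simp add: inner_diff_left)
        ultimately show "inner (k *\<^sub>R e - a) (b - v) \<le> 0"
          by (simp add: inner_diff_right k_def)
      qed
      then have "k * l \<le> inner a (x - v)"
        by (simp add: inner_diff_left inner_diff_right l_def algebra_simps)
      moreover have "inner a (x - v) = l * (inner a y - inner a v)"
        using l by (simp add: y_def inner_add_right)
      moreover have "l * (inner a y - inner a v) < l * k"
        using a(1) l by (simp add: k_def)
      ultimately show False by (simp add: mult.commute)
    qed
    then have "(1 - l) *\<^sub>R v + l *\<^sub>R y \<in> Q"
      using \<open>convex Q\<close> vQ l by (intro convexD) (auto simp: H_def)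
    moreover have "(1 - l) *\<^sub>R v + l *\<^sub>R y = x"
      using l by (simp add: y_def algebra_simps)
    ultimately show ?thesis by simp
  qed
qed

subsection \<open>Products with a pyramid\<close>

lemma diag_block_mat_comb:
  "k + n \<le> r \<Longrightarrow> diag_block k n (mat_comb r a A b B) = mat_comb n a (diag_block k n A) b (diag_block k n B)"
  by (auto simp: diag_block_def mat_comb_def)

lemma diag_block_add_corner:
  "A \<in> carrier_mat n n \<Longrightarrow> diag_block 0 n (add_corner n A y) = A"
  by (auto simp: diag_block_def add_corner_def)

lemma diag_block_0_diag_block: "diag_block 0 n (diag_block k n A) = diag_block k n A"
  by (auto simp: diag_block_def)

lemma frobenius_inner_diag_block:
  assumes W: "W \<in> psd_matrices r" and "t \<le> r" and W0: "\<And>i. i < t \<Longrightarrow> W $$ (i, i) = 0"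
  shows "frobenius_inner (diag_block t (r - t) W) (diag_block t (r - t) Y) = frobenius_inner W Y"
proof -
  have "W $$ (i, j) = 0" if "i < r" "j < r" "i < t \<or> j < t" for i j
    using that psd_diag_zero[OF W, of i j] psd_diag_zero[OF W, of j i] W0 by blast
  then have "frobenius_inner W Y = (\<Sum>i<r-t. \<Sum>j<r-t. W $$ (t + i, t + j) * Y $$ (t + i, t + j))"
    unfolding frobenius_inner_carrier[OF psd_carrier[OF W]]
    by (intro double_sum_restrict_block) (use \<open>t \<le> r\<close> in auto)
  then show ?thesis by (simp add: frobenius_inner_def diag_block_def)
qed

text \<open>Some \<open>Y\<close> over \<open>X\<close> is positive definite on the first \<open>t\<close> coordinates, so
  \<open>C Y - e\<^sub>i e\<^sub>i\<^sup>T\<close> is psd for some \<open>C\<close>; its inner product with \<open>W\<close> is \<open>- W\<^sub>i\<^sub>i\<close>.\<close>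

lemma orthogonal_supported_on_kernel:
  fixes S :: "('a::euclidean_space \<times> real mat \<times> real) set"
  assumes S: "\<forall>(a, U, b) \<in> S. U \<in> psd_matrices r" and "t \<le> r" and "convex X"
    and ne: "\<exists>x \<in> X. \<exists>Y. feasible S r x Y"
    and zero: "\<forall>x \<in> X. \<forall>Y i. feasible S r x Y \<longrightarrow> t \<le> i \<longrightarrow> i < r \<longrightarrow> Y $$ (i, i) = 0"
    and triv: "\<forall>c. (\<forall>i. t \<le> i \<longrightarrow> i < r \<longrightarrow> c i = 0) \<longrightarrow>
       (\<forall>x \<in> X. \<forall>Y. feasible S r x Y \<longrightarrow> bil_form r Y c c = 0) \<longrightarrow> (\<forall>i<r. c i = 0)"
    and W: "W \<in> psd_matrices r" and orth: "\<And>x Y. x \<in> X \<Longrightarrow> feasible S r x Y \<Longrightarrow> frobenius_inner W Y = 0"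
    and i: "i < t"
  shows "W $$ (i, i) = 0"
proof -
  define G where "G = {Y. \<exists>x \<in> X. feasible S r x Y}"
  have G: "Y \<in> psd_matrices r" if "Y \<in> G" for Y using that feasibleD(1) by (auto simp: G_def)
  have block: "bil_form t (diag_block 0 t Y) v v = bil_form r Y v v" if "Y \<in> G" for Y v
  proof -
    have "Y $$ (k, l) = 0" if "k < r" "l < r" "t \<le> k \<or> t \<le> l" for k l
      using that psd_diag_zero[OF G[OF \<open>Y \<in> G\<close>], of k l] psd_diag_zero[OF G[OF \<open>Y \<in> G\<close>], of l k]
        zero \<open>Y \<in> G\<close> by (auto simp: G_def)
    then have "bil_form r Y v v = (\<Sum>k<t. \<Sum>l<t. Y $$ (0 + k, 0 + l) * v (0 + k) * v (0 + l))"
      unfolding bil_form_def by (intro double_sum_restrict_block) (use \<open>t \<le> r\<close> in auto)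
    then show ?thesis by (simp add: bil_form_def diag_block_def)
  qed
  have "\<exists>A \<in> diag_block 0 t ` G. pos_def t A"
  proof (rule pos_def_of_family)
    show "diag_block 0 t ` G \<subseteq> psd_matrices t"
      using G \<open>t \<le> r\<close> by (auto intro!: diag_block_psd[of _ r])
    show "diag_block 0 t ` G \<noteq> {}" using ne by (auto simp: G_def)
    show "mat_comb t (1/2) A (1/2) B \<in> diag_block 0 t ` G"
      if AB: "A \<in> diag_block 0 t ` G" "B \<in> diag_block 0 t ` G" for A B
    proof -
      obtain Y Z where YZ: "Y \<in> G" "A = diag_block 0 t Y" "Z \<in> G" "B = diag_block 0 t Z"
        using AB by blast
      then obtain x y where xy: "x \<in> X" "feasible S r x Y" "y \<in> X" "feasible S r y Z"
        by (auto simp: G_def)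
      have "feasible S r ((1/2) *\<^sub>R x + (1/2) *\<^sub>R y) (mat_comb r (1/2) Y (1/2) Z)"
        using xy by (intro feasible_convex[OF S]) auto
      moreover have "(1/2) *\<^sub>R x + (1/2) *\<^sub>R y \<in> X"
        using \<open>convex X\<close> xy by (intro convexD) auto
      ultimately have "mat_comb r (1/2) Y (1/2) Z \<in> G" by (auto simp: G_def)
      then show ?thesis
        using diag_block_mat_comb[of 0 t r "1/2" Y "1/2" Z] \<open>t \<le> r\<close> YZ by (intro image_eqI) auto
    qed
    show "\<forall>i<t. u i = 0" if u: "\<forall>A \<in> diag_block 0 t ` G. bil_form t A u u = 0" for u
    proof -
      \<comment> \<open>Coordinates of \<open>u\<close> beyond \<open>t\<close> are arbitrary and
        are cleared so that \<open>triv\<close> applies.\<close>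
      define c where "c = (\<lambda>i. if i < t then u i else 0)"
      have "bil_form r Y c c = 0" if "Y \<in> G" for Y
      proof -
        have "bil_form t (diag_block 0 t Y) c c = bil_form t (diag_block 0 t Y) u u"
          by (rule bil_form_cong) (auto simp: c_def)
        then show ?thesis using u that block by simp
      qed
      then have ker: "\<forall>x \<in> X. \<forall>Y. feasible S r x Y \<longrightarrow> bil_form r Y c c = 0"
        by (auto simp: G_def)
      have "\<forall>i. t \<le> i \<longrightarrow> i < r \<longrightarrow> c i = 0" by (simp add: c_def)
      with ker have c0: "\<forall>i<r. c i = 0" using triv by blast
      have "u i = 0" if "i < t" for i
        using c0[rule_format, of i] that \<open>t \<le> r\<close> by (simp add: c_def)
      then show ?thesis by blast
    qed
  qed
  then obtain Y where Y: "Y \<in> G" "pos_def t (diag_block 0 t Y)" by blast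
  have "diag_block 0 t Y \<in> psd_matrices t"
    using G[OF Y(1)] \<open>t \<le> r\<close> by (intro diag_block_psd[of _ r]) auto
  then obtain C where C: "C \<ge> 0" "\<And>v. (v i)\<^sup>2 \<le> C * bil_form r Y v v"
    using pos_def_coordinate_bound[OF _ Y(2) i] block[OF Y(1)] by auto
  define E where "E = mat r r (\<lambda>(k, l). of_bool (k = i) * of_bool (l = i) :: real)"
  have ir: "i < r" using i \<open>t \<le> r\<close> by simp
  have double: "(\<Sum>k<r. \<Sum>l<r. f k l * (of_bool (k = i) * of_bool (l = i))) = (f i i :: real)" for f
  proof -
    have "(\<Sum>k<r. \<Sum>l<r. f k l * (d k * d l)) = (\<Sum>k<r. (\<Sum>l<r. f k l * d l) * d k)"
      for d :: "nat \<Rightarrow> real"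
      by (simp add: sum_distrib_left sum_distrib_right mult_ac)
    then have "(\<Sum>k<r. \<Sum>l<r. f k l * (of_bool (k = i) * of_bool (l = i))) =
        (\<Sum>k<r. (\<Sum>l<r. f k l * of_bool (l = i)) * of_bool (k = i))" .
    also have "\<dots> = f i i" using ir by (simp add: sum_of_bool_eq)
    finally show ?thesis .
  qed
  have bE: "bil_form r E v v = (v i)\<^sup>2" for v
    using double[of "\<lambda>k l. v k * v l"] by (simp add: bil_form_def E_def power2_eq_square mult_ac)
  have fE: "frobenius_inner W E = W $$ (i, i)"
    using double[of "\<lambda>k l. W $$ (k, l)"] psd_carrier[OF W] by (simp add: frobenius_inner_carrier E_def)
  have "mat_comb r C Y (-1) E \<in> psd_matrices r"
  proof (rule psdI)
    show "mat_comb r C Y (-1) E $$ (k, l) = mat_comb r C Y (-1) E $$ (l, k)" if "k < r" "l < r" for k l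
      using that psd_sym[OF G[OF Y(1)] that] by (simp add: mat_comb_def E_def)
    show "bil_form r (mat_comb r C Y (-1) E) v v \<ge> 0" for v
      using C(2)[of v] by (simp add: bil_form_mat_comb bE)
  qed (simp add: mat_comb_def)
  then have "frobenius_inner W (mat_comb r C Y (-1) E) \<ge> 0"
    by (rule psd_frobenius_inner_nonneg[OF W])
  moreover have "frobenius_inner W Y = 0" using Y(1) orth by (auto simp: G_def)
  ultimately have "W $$ (i, i) \<le> 0"
    by (simp add: frobenius_inner_mat_comb[OF psd_carrier[OF W]] fE)
  moreover have "W $$ (i, i) \<ge> 0"
    using psd_nonneg[OF W, of "\<lambda>k. if k = i then 1 else 0"] ir by (simp add: bil_form_unit)
  ultimately show ?thesis by simp
qed

text \<open>\<open>r - t\<close> is the dimension of the common kernel of the matrices feasible over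
  the apex; it is the room left for the cone of \<open>Q1\<close> at \<open>v\<close>.\<close>

lemma pyramid_product_formulations:
  fixes Q1 :: "'a::euclidean_space set" and Q2 :: "'b::euclidean_space set"
  assumes pyr: "pyramid_with Q1 B v" and "Q2 \<noteq> {}"
    and form: "has_sdp_formulation (Q1 \<times> Q2) r"
    and min: "\<And>n. has_sdp_formulation (Q1 \<times> Q2) n \<Longrightarrow> r \<le> n"
  shows "\<exists>t \<le> r. has_sdp_formulation Q2 t \<and> has_sdp_formulation Q1 (Suc (r - t))"
proof -
  have Q1: "Q1 = convex hull (B \<union> {v})" using pyr by (simp add: pyramid_with_def)
  have vQ1: "v \<in> Q1" unfolding Q1 by (intro hull_inc) simp
  obtain S0 where S0: "sdp_form S0 r (Q1 \<times> Q2)"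
    using form has_sdp_formulation_iff by blast
  \<comment> \<open>Feasibility already forces the second component into \<open>Q2\<close>; with
    \<open>UNIV\<close> the set is plainly convex.\<close>
  define X where "X = {v} \<times> (UNIV :: 'b set)"
  obtain P Q t where S: "sdp_form (transform_form Q S0) r (Q1 \<times> Q2)" and t: "t \<le> r"
    and zero: "\<forall>x \<in> X. \<forall>Y i. feasible (transform_form Q S0) r x Y \<longrightarrow> t \<le> i \<longrightarrow> i < r \<longrightarrow> Y $$ (i, i) = 0"
    and triv: "\<forall>c. (\<forall>i. t \<le> i \<longrightarrow> i < r \<longrightarrow> c i = 0) \<longrightarrow>
       (\<forall>x \<in> X. \<forall>Y. feasible (transform_form Q S0) r x Y \<longrightarrow> bil_form r Y c c = 0) \<longrightarrow>
       (\<forall>i<r. c i = 0)"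
    by (rule adapted_form[OF S0, of X])
  define S where "S = transform_form Q S0"
  note S = S[folded S_def] and zero = zero[folded S_def] and triv = triv[folded S_def]
  have psd: "\<forall>(a, U, b) \<in> S. U \<in> psd_matrices r" using S by (simp add: sdp_form_def)

  \<comment> \<open>The slice at \<open>v\<close>: the first component is fixed and its contribution
    moves to the right-hand side.\<close>
  define S2 where "S2 = (\<lambda>(a, U, b). (snd a, U, b - inner (fst a) v)) ` S"
  have feas2: "feasible S2 r y Y \<longleftrightarrow> feasible S r (v, y) Y" for y Y
    unfolding feasible_def S2_def by (auto simp: inner_prod_def algebra_simps split_beta)
  have "sdp_form S2 r Q2"
    unfolding sdp_form_def feas2
  proof (intro conjI allI)
    show "\<forall>(a, U, b) \<in> S2. U \<in> psd_matrices r" using psd by (auto simp: S2_def)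
    show "y \<in> Q2 \<longleftrightarrow> (\<exists>Y. feasible S r (v, y) Y)" for y
      using sdp_formD(2,3)[OF S, of "(v, y)"] vQ1 by blast
  qed
  then have has2: "has_sdp_formulation Q2 t"
    using t by (rule has_sdp_formulation_restrict) (use zero in \<open>auto simp: feas2 X_def\<close>)

  have "Q1 \<times> Q2 \<noteq> {}" using vQ1 \<open>Q2 \<noteq> {}\<close> by blast
  then obtain z0 Y0 where Y0: "feasible S r z0 Y0" "pos_def r Y0"
    using minimal_form_pos_def[OF S min] by blast
  obtain e where e: "\<And>b. b \<in> B \<Longrightarrow> inner e (b - v) = 1"
    using pyramid_height_functional[of v B] pyr by (auto simp: pyramid_with_def)
  define n where "n = r - t"
  define D where "D = {(g, W). W \<in> psd_matrices r \<and> (\<forall>i<t. W $$ (i, i) = 0) \<and>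
    (\<forall>x y Y. feasible S r (x, y) Y \<longrightarrow> inner g v - inner g x = frobenius_inner W Y)}"
  have D_psd: "W \<in> psd_matrices r" and D_block: "diag_block t n W \<in> psd_matrices n" if "(g, W) \<in> D" for g W
    using that t diag_block_psd[of W r t n] by (auto simp: D_def n_def)
  have D_ex: "\<exists>W. (g, W) \<in> D" if g: "\<And>x. x \<in> Q1 \<Longrightarrow> inner g x \<le> inner g v" for g
  proof -
    have "\<exists>W c. W \<in> psd_matrices r \<and> c \<ge> 0 \<and>
        (\<forall>x Y. feasible S r x Y \<longrightarrow> inner g v - inner (g, 0) x = frobenius_inner W Y + c)"
      by (rule sdp_duality[OF S Y0]) (use g in \<open>auto simp: inner_prod_def\<close>)
    then obtain W c where W: "W \<in> psd_matrices r" "c \<ge> 0"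
      and eq: "\<And>x y Y. feasible S r (x, y) Y \<Longrightarrow> inner g v - inner g x = frobenius_inner W Y + c"
      by (fastforce simp: inner_prod_def)
    obtain y Y where yY: "feasible S r (v, y) Y"
      using \<open>Q2 \<noteq> {}\<close> vQ1 sdp_formD(3)[OF S] by blast
    have nonneg: "frobenius_inner W Y \<ge> 0" if "feasible S r x Y" for x Y
      using psd_frobenius_inner_nonneg[OF W(1) feasibleD(1)[OF that]] .
    \<comment> \<open>The slack vanishes over the apex and is a sum of two nonnegative
      terms.\<close>
    have c: "c = 0" using eq[OF yY] nonneg[OF yY] W(2) by simp
    have "W $$ (i, i) = 0" if "i < t" for i
    proof (rule orthogonal_supported_on_kernel[OF psd t _ _ zero triv W(1) _ that])
      show "convex X" unfolding X_def by (intro convex_Times) auto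
      show "\<exists>x \<in> X. \<exists>Y. feasible S r x Y" using yY by (auto simp: X_def)
      fix x Y assume x: "x \<in> X" "feasible S r x Y"
      then obtain y where "x = (v, y)" by (auto simp: X_def)
      then show "frobenius_inner W Y = 0" using eq[of v y Y] x(2) c by simp
    qed
    then show ?thesis using W(1) eq c by (auto simp: D_def)
  qed

  \<comment> \<open>The corner entry is the slack \<open>1 - inner e (x - v)\<close> of the base
    inequality; the tight inequalities ignore it and use the block of size \<open>n\<close>.\<close>
  define S1 where "S1 = insert (e, add_corner n (0\<^sub>m n n) 1, inner e v + 1)
    ((\<lambda>(g, W). (g, add_corner n (diag_block t n W) 0, inner g v)) ` D)"
  have zero_psd: "0\<^sub>m n n \<in> psd_matrices n"
    by (intro psdI) (auto simp: bil_form_def)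
  have frob: "frobenius_inner (add_corner n A y) (add_corner n V s) = frobenius_inner A V + y * s"
    if "A \<in> carrier_mat n n" "V \<in> carrier_mat n n" for A V y s
  proof -
    have "add_corner n V s \<in> carrier_mat (Suc n) (Suc n)" "add_corner n V s $$ (n, n) = s"
      by (auto simp: add_corner_def)
    moreover have "diag_block 0 n A = A" using that by (auto simp: diag_block_def)
    ultimately show ?thesis
      using that by (simp add: frobenius_inner_add_corner diag_block_add_corner)
  qed
  have "sdp_form S1 (Suc n) Q1"
    unfolding sdp_form_def
  proof (intro conjI allI iffI)
    show "\<forall>(a, U, b) \<in> S1. U \<in> psd_matrices (Suc n)"
      using zero_psd D_block psd_carrier by (auto simp: S1_def add_corner_psd_iff)
  next
    fix x assume x: "x \<in> Q1"
    obtain y Y where Y: "feasible S r (x, y) Y"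
      using x \<open>Q2 \<noteq> {}\<close> sdp_formD(3)[OF S] by blast
    define s where "s = 1 - inner e (x - v)"
    have "inner e b \<le> 1 + inner e v" if "b \<in> B" for b
      using e[OF that] by (simp add: inner_diff_right)
    then have "Q1 \<subseteq> {z. inner e z \<le> 1 + inner e v}"
      unfolding Q1 by (intro hull_minimal convex_halfspace_le) auto
    then have "s \<ge> 0" using x by (auto simp: s_def inner_diff_right)
    define V where "V = diag_block t n Y"
    have V: "V \<in> psd_matrices n"
      unfolding V_def using feasibleD(1)[OF Y] t by (intro diag_block_psd[of _ r]) (auto simp: n_def)
    have "inner a x + frobenius_inner U (add_corner n V s) = b" if U: "(a, U, b) \<in> S1" for a U b
    proof -
      consider "a = e" "U = add_corner n (0\<^sub>m n n) 1" "b = inner e v + 1"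
        | W where "(a, W) \<in> D" "U = add_corner n (diag_block t n W) 0" "b = inner a v"
        using U unfolding S1_def by auto
      then show ?thesis
      proof cases
        case 1
        have "frobenius_inner (0\<^sub>m n n) V = 0" by (simp add: frobenius_inner_def)
        then show ?thesis
          using 1 psd_carrier[OF V] by (simp add: frob s_def inner_diff_right)
      next
        case (2 W)
        have "frobenius_inner U (add_corner n V s) = frobenius_inner (diag_block t n W) V"
          unfolding 2 using frob[OF psd_carrier[OF D_block[OF 2(1)]] psd_carrier[OF V]] by simp
        also have "\<dots> = frobenius_inner W Y"
          unfolding V_def n_def using 2(1) t by (intro frobenius_inner_diag_block) (auto simp: D_def)
        also have "\<dots> = inner a v - inner a x" using 2(1) Y by (auto simp: D_def)
        finally show ?thesis using 2(3) by simp
      qed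
    qed
    then have "feasible S1 (Suc n) x (add_corner n V s)"
      unfolding feasible_def using V \<open>s \<ge> 0\<close> psd_carrier[OF V] by (auto simp: add_corner_psd_iff)
    then show "\<exists>Y. feasible S1 (Suc n) x Y" by blast
  next
    fix x assume "\<exists>Y. feasible S1 (Suc n) x Y"
    then obtain Z where Z: "feasible S1 (Suc n) x Z" by blast
    have Zp: "Z \<in> psd_matrices (Suc n)" using Z by (rule feasibleD)
    note frob' = frobenius_inner_add_corner[OF psd_carrier[OF Zp]]
    show "x \<in> Q1"
    proof (rule pyramid_apex_cut[OF pyr e])
      fix g assume "\<And>z. z \<in> Q1 \<Longrightarrow> inner g z \<le> inner g v"
      then obtain W where W: "(g, W) \<in> D" using D_ex by blast
      then have "(g, add_corner n (diag_block t n W) 0, inner g v) \<in> S1"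
        unfolding S1_def by force
      from feasibleD(2)[OF Z this] have "inner g x + frobenius_inner (diag_block t n W) (diag_block 0 n Z) = inner g v"
        by (simp add: frob' diag_block_0_diag_block)
      \<comment> \<open>\<open>Z\<close> need not come from a matrix feasible for \<open>S\<close>:
        nonnegativity of inner products of psd matrices alone recovers the inequality.\<close>
      moreover have "frobenius_inner (diag_block t n W) (diag_block 0 n Z) \<ge> 0"
        using Zp by (intro psd_frobenius_inner_nonneg[OF D_block[OF W]] diag_block_psd[of _ "Suc n"]) auto
      ultimately show "inner g x \<le> inner g v" by simp
    next
      have "(e, add_corner n (0\<^sub>m n n) 1, inner e v + 1) \<in> S1" by (simp add: S1_def)
      then have "inner e x + frobenius_inner (add_corner n (0\<^sub>m n n) 1) Z = inner e v + 1"
        by (rule feasibleD(2)[OF Z])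
      moreover have "frobenius_inner (diag_block 0 n (0\<^sub>m n n)) (diag_block 0 n Z) = 0"
        by (simp add: frobenius_inner_def diag_block_def)
      ultimately have "inner e x + Z $$ (n, n) = inner e v + 1"
        by (simp add: frob')
      moreover have "Z $$ (n, n) \<ge> 0"
        using psd_nonneg[OF Zp, of "\<lambda>k. if k = n then 1 else 0"]
        by (simp add: bil_form_unit)
      ultimately show "inner e (x - v) \<le> 1" by (simp add: inner_diff_right)
    qed
  qed
  then show ?thesis
    using has2 t unfolding has_sdp_formulation_iff n_def by blast
qed

section \<open>From formulations to the minimal size\<close>

lemma xc_SDP_le: "has_sdp_formulation K r \<Longrightarrow> xc_SDP K \<le> enat r"
  unfolding xc_SDP_def by (rule INF_lower) simp

lemma xc_SDP_attained:
  assumes "xc_SDP K = enat r"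
  shows "has_sdp_formulation K r" and "has_sdp_formulation K n \<Longrightarrow> r \<le> n"
proof -
  let ?R = "{r. has_sdp_formulation K r}"
  have "?R \<noteq> {}"
  proof
    assume *: "?R = {}"
    have "xc_SDP K = \<infinity>" unfolding xc_SDP_def * by (simp add: top_enat_def)
    then show False using assms by simp
  qed
  then have "xc_SDP K \<in> enat ` ?R"
    unfolding xc_SDP_def Inf_enat_def by (auto intro: LeastI)
  then show "has_sdp_formulation K r" using assms by auto
  show "has_sdp_formulation K n \<Longrightarrow> r \<le> n" using xc_SDP_le[of K n] assms by simp
qed

lemma has_sdp_formulation_swap:
  fixes A :: "'a::euclidean_space set" and B :: "'b::euclidean_space set"
  assumes "has_sdp_formulation (A \<times> B) r"
  shows "has_sdp_formulation (B \<times> A) r"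
proof -
  obtain S where S: "sdp_form S r (A \<times> B)" using assms has_sdp_formulation_iff by blast
  define S' where "S' = (\<lambda>(a, U, b). (prod.swap a, U, b)) ` S"
  have feas: "feasible S' r x Y \<longleftrightarrow> feasible S r (prod.swap x) Y" for x Y
    unfolding feasible_def S'_def by (auto simp: inner_prod_def add.commute split_beta)
  have "sdp_form S' r (B \<times> A)"
    unfolding sdp_form_def feas
  proof (intro conjI allI)
    show "\<forall>(a, U, b) \<in> S'. U \<in> psd_matrices r" using S by (auto simp: S'_def sdp_form_def)
    show "x \<in> B \<times> A \<longleftrightarrow> (\<exists>Y. feasible S r (prod.swap x) Y)" for x
      using sdp_formD(2,3)[OF S, of "prod.swap x"] by (cases x) auto
  qed
  then show ?thesis using has_sdp_formulation_iff by blast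
qed

lemma xc_SDP_swap:
  "xc_SDP ((A::'a::euclidean_space set) \<times> (B::'b::euclidean_space set)) = xc_SDP (B \<times> A)"
proof -
  have "has_sdp_formulation (A \<times> B) r \<longleftrightarrow> has_sdp_formulation (B \<times> A) r" for r
    using has_sdp_formulation_swap[of A B r] has_sdp_formulation_swap[of B A r] by blast
  then show ?thesis by (simp add: xc_SDP_def)
qed

text \<open>The sizes \<open>t\<close> and \<open>Suc (r - t)\<close> add up to
  \<open>r + 1\<close>; if the product has value infinity there is nothing to show. Moving the 1 to
  the right avoids subtraction in \<open>enat\<close>.\<close>

lemma xc_SDP_pyramid_times:
  fixes Q1 :: "'a::euclidean_space set" and Q2 :: "'b::euclidean_space set"
  assumes "is_pyramid Q1" and "Q2 \<noteq> {}"
  shows "xc_SDP Q1 + xc_SDP Q2 \<le> xc_SDP (Q1 \<times> Q2) + 1"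
proof (cases "xc_SDP (Q1 \<times> Q2)")
  case (enat r)
  obtain B v where "pyramid_with Q1 B v" using assms by (auto simp: is_pyramid_def)
  then obtain t where t: "t \<le> r" "has_sdp_formulation Q2 t" "has_sdp_formulation Q1 (Suc (r - t))"
    using pyramid_product_formulations[of Q1 B v Q2 r] assms xc_SDP_attained[OF enat] by blast
  have "xc_SDP Q1 + xc_SDP Q2 \<le> enat (Suc (r - t)) + enat t"
    using t by (intro add_mono xc_SDP_le)
  also have "\<dots> = xc_SDP (Q1 \<times> Q2) + 1"
    using t(1) by (simp add: enat one_enat_def)
  finally show ?thesis .
qed simp

theorem theorem10:
  fixes Q1 :: "'a::euclidean_space set" and Q2 :: "'b::euclidean_space set"
  assumes "polytope Q1" and "polytope Q2"
    and "Q1 \<noteq> {}" and "Q2 \<noteq> {}"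
    and "is_pyramid Q1 \<or> is_pyramid Q2"
  shows "xc_SDP Q1 + xc_SDP Q2 \<le> xc_SDP (Q1 \<times> Q2) + 1"
  using assms(5)
proof
  assume "is_pyramid Q1"
  then show ?thesis
    using assms by (intro xc_SDP_pyramid_times)
next
  assume "is_pyramid Q2"
  then have "xc_SDP Q2 + xc_SDP Q1 \<le> xc_SDP (Q2 \<times> Q1) + 1"
    using assms by (intro xc_SDP_pyramid_times)
  then show ?thesis
    by (simp add: add.commute xc_SDP_swap[of Q1 Q2])
qed

end
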